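(* Let $\theta\neq0$ and let $[X,Y]\in\mathcal D$. Decompose $X$ into a bulk and tails by writing $$X=\begin{cases}X_{\mathrm{bulk}} & \text{with probability } p,\\ w X_{\mathrm{tail}} & \text{with probability } 1-p,\end{cases}\qquad \mathrm{P}(X_{\mathrm{tail}}=0)=0 .$$ Then only the bulk matters in the far-tail limit, that is $$s^\theta(X,Y)\xrightarrow{w\to\infty} s^\theta(X_{\mathrm{bulk}},Y),\qquad c^\theta_\pm(X,Y)\xrightarrow{w\to\infty} c^\theta_\pm(X_{\mathrm{bulk}},Y).$$ One can also pass to this limit with both $X$ and $Y$ decomposed into bulk and tails in this way (only the bulks $X_{\mathrm{bulk}}$ and $Y_{\mathrm{bulk}}$ then remain in the limit).
   Context: $\mathcal D$ denotes the class of (one- or multi-dimensional) random variables with strictly positive-definite Lebesgue density, together with the limiting case of an atom at $0$ (null components such as $X-X=0$ are allowed). Characteristic functions of members of $\mathcal D$ are real-valued and positive. For $\theta\ne0$: $l^\theta(X):=-\frac{2}{\theta^2}\ln\mathbb E[e^{i\theta X}]$; the symmetric codifference is $s^\theta(X,Y):=\frac14\big(l^\theta(X+Y)-l^\theta(X-Y)\big)$; the asymmetric codifferences are $c^\theta_\pm(X,Y):=\pm\frac12\big(l^\theta(X)+l^\theta(Y)-l^\theta(X\mp Y)\big)$. These codifferences are defined for pairs $[X,Y]\in\mathcal D$.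
   Formalization: With both X and Y decomposed and a common scale w, P(X_tail+Y_tail=0)=P(X_tail−Y_tail=0)=0 is also assumed; without it the claim fails (e.g. X_tail=Y_tail gives X−Y an atom at 0). Letting the two scales tend to infinity successively needs no such assumption. *)

theory Defs
  imports "HOL-Probability.Probability"
begin

definition strictly_positive_definite :: "('a::real_vector \<Rightarrow> real) \<Rightarrow> bool" where
  "strictly_positive_definite f \<longleftrightarrow>
     (\<forall>S (c :: 'a \<Rightarrow> complex). finite S \<and> (\<exists>x\<in>S. c x \<noteq> 0) \<longrightarrow>
        (\<Sum>x\<in>S. \<Sum>y\<in>S. c x * cnj (c y) * of_real (f (x - y))) \<in> \<real> \<and>
        0 < Re (\<Sum>x\<in>S. \<Sum>y\<in>S. c x * cnj (c y) * of_real (f (x - y))))"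

definition spd_law :: "'a::euclidean_space measure \<Rightarrow> bool" where
  "spd_law \<nu> \<longleftrightarrow> prob_space \<nu> \<and>
     (\<exists>f\<in>borel_measurable borel. (\<forall>x. 0 \<le> f x) \<and> strictly_positive_definite f \<and>
        \<nu> = density lborel (\<lambda>x. ennreal (f x)))"

text \<open>
  The class of laws with a strictly positive-definite Lebesgue density, together with the limiting
  cases in which some components, or linear combinations of components, have an atom at 0 or vanish.
  These are the mixtures of images of laws with a strictly positive-definite density under linear
  maps \<open>A j\<close> that may be singular: \<open>A j = 0\<close> gives an atom at 0, and the image under
  \<open>\<lambda>(x, y). (x, x)\<close> is the law of a pair \<open>(X, X)\<close>, for which \<open>X - X\<close> is a null component. In
  dimension one the laws are the convex combinations of such a density and the point mass at 0.
  In any dimension the absolutely continuous members have a strictly positive-definite density.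
  Strict positive-definiteness of a density alone does not exclude zeros of the characteristic
  function (the triangular one has zeros), so positivity is a separate condition.
\<close>

definition class_D :: "'a::euclidean_space measure \<Rightarrow> bool" where
  "class_D \<mu> \<longleftrightarrow> prob_space \<mu> \<and> sets \<mu> = sets borel \<and>
     (\<exists>(n::nat) (a :: nat \<Rightarrow> real) (A :: nat \<Rightarrow> 'a \<Rightarrow> 'a) (\<nu> :: nat \<Rightarrow> 'a measure).
        (\<forall>j<n. 0 \<le> a j \<and> linear (A j) \<and> spd_law (\<nu> j)) \<and>
        (\<forall>E\<in>sets borel. measure \<mu> E = (\<Sum>j<n. a j * measure (\<nu> j) (A j -` E)))) \<and>
     (\<forall>t. (CLINT x|\<mu>. iexp (t \<bullet> x)) \<in> \<real> \<and> 0 < Re (CLINT x|\<mu>. iexp (t \<bullet> x)))"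

abbreviation pair_in_D :: "'s measure \<Rightarrow> ('s \<Rightarrow> real) \<Rightarrow> ('s \<Rightarrow> real) \<Rightarrow> bool" where
  "pair_in_D M X Y \<equiv> class_D (distr M borel (\<lambda>\<omega>. (X \<omega>, Y \<omega>)))"

text \<open>
  For pairs in the class the expectation below is a positive real number, so \<open>Re\<close> is only a
  coercion.
\<close>

definition log_char :: "'s measure \<Rightarrow> real \<Rightarrow> ('s \<Rightarrow> real) \<Rightarrow> real" where
  "log_char M \<theta> X = - (2 / \<theta>\<^sup>2) * ln (Re (CLINT \<omega>|M. iexp (\<theta> * X \<omega>)))"

definition sym_codiff :: "'s measure \<Rightarrow> real \<Rightarrow> ('s \<Rightarrow> real) \<Rightarrow> ('s \<Rightarrow> real) \<Rightarrow> real" where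
  "sym_codiff M \<theta> X Y =
     1 / 4 * (log_char M \<theta> (\<lambda>\<omega>. X \<omega> + Y \<omega>) - log_char M \<theta> (\<lambda>\<omega>. X \<omega> - Y \<omega>))"

definition asym_codiff_plus ::
    "'s measure \<Rightarrow> real \<Rightarrow> ('s \<Rightarrow> real) \<Rightarrow> ('s \<Rightarrow> real) \<Rightarrow> real" where
  "asym_codiff_plus M \<theta> X Y =
     1 / 2 * (log_char M \<theta> X + log_char M \<theta> Y - log_char M \<theta> (\<lambda>\<omega>. X \<omega> - Y \<omega>))"

definition asym_codiff_minus ::
    "'s measure \<Rightarrow> real \<Rightarrow> ('s \<Rightarrow> real) \<Rightarrow> ('s \<Rightarrow> real) \<Rightarrow> real" where
  "asym_codiff_minus M \<theta> X Y =
     - (1 / 2) * (log_char M \<theta> X + log_char M \<theta> Y - log_char M \<theta> (\<lambda>\<omega>. X \<omega> + Y \<omega>))"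

text \<open>
  The random choice between bulk and tail is carried by a selector \<open>B\<close>; independence of \<open>B\<close> from
  the other variables is a hypothesis where it is used.
\<close>

definition bulk_tail ::
    "('s \<Rightarrow> bool) \<Rightarrow> ('s \<Rightarrow> real) \<Rightarrow> ('s \<Rightarrow> real) \<Rightarrow> real \<Rightarrow> 's \<Rightarrow> real" where
  "bulk_tail B X_bulk X_tail w \<omega> = (if B \<omega> then X_bulk \<omega> else w * X_tail \<omega>)"

text \<open>Independence of the event \<open>B\<close> from the sigma-algebra generated by \<open>V\<close>.\<close>

abbreviation selector_indep ::
    "'s measure \<Rightarrow> ('s \<Rightarrow> bool) \<Rightarrow> 'v measure \<Rightarrow> ('s \<Rightarrow> 'v) \<Rightarrow> bool" where
  "selector_indep M B N V \<equiv>
     prob_space.indep_set M {{\<omega> \<in> space M. B \<omega>}} (sets (vimage_algebra (space M) V N))"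

end

theory Submission
  imports Defs
begin

text \<open>
  By independence of the selector, the characteristic function of a linear combination involving
  the decomposed variable is \<open>p\<close> times that with the bulk in its place, plus a tail term. The
  tail term vanishes as \<open>w \<rightarrow> \<infinity>\<close> by the Riemann--Lebesgue lemma. The tail is absolutely
  continuous on the tail event, although only \<open>P(X_tail = 0) = 0\<close> is assumed: every
  linear functional of a law in the class is absolutely continuous off \<open>0\<close>, since a functional of a
  singular linear image of a density is either identically \<open>0\<close> or nondegenerate. The codifferences are
  thus limits of logarithms that are off by \<open>ln p\<close>, \<open>ln q\<close> or \<open>ln (p q)\<close>, and these constants cancel.
\<close>

section \<open>The Riemann--Lebesgue lemma\<close>

text \<open>The tail may depend on the other variable, and conditioning on the tail event would need
  \<open>p < 1\<close>. So the Riemann-Lebesgue lemma is extended to integrals of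
  \<open>W * iexp (t * Z)\<close> with a complex weight \<open>W\<close>, where absolute continuity
  of \<open>Z\<close> is demanded only where \<open>W\<close> is nonzero. The weight is the
  indicator of a tail event times the part of the exponential that is free of \<open>w\<close>.
  Being absolutely continuous is invariant under scaling, so a single pair in the class, at a single
  positive \<open>w\<close>, settles it for the tail and hence for the whole limit. When both
  variables are in their tails at the same scale, the growing quantity is
  \<open>X_tail + s * Y_tail\<close> with \<open>s\<close> equal to 1 or -1, and this may
  degenerate: if \<open>X_tail = Y_tail\<close>, the difference is 0 on the double tail event for
  every \<open>w\<close>, and a term \<open>(1 - p) * (1 - q)\<close> survives in its characteristic
  function. This is why the joint limit asks that sum and difference of the tails almost surely do
  not vanish, while in the iterated limits only one scale grows at a time.\<close>

lemma integral_iexp_interval_tendsto_0: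
  fixes a b :: real
  shows "((\<lambda>t. CLBINT x. indicator {a..b} x *\<^sub>R iexp (t * x)) \<longlongrightarrow> 0) at_infinity"
proof (cases "a \<le> b")
  case True
  have eq: "(CLBINT x. indicator {a..b} x *\<^sub>R iexp (t * x)) = (iexp (t * b) - iexp (t * a)) / (\<i> * t)"
    if "t \<noteq> 0" for t
  proof -
    have "(CLBINT x. indicator {a..b} x *\<^sub>R iexp (t * x)) = iexp (t * b) / (\<i> * t) - iexp (t * a) / (\<i> * t)"
    proof (rule integral_FTC_Icc[OF True, where F = "\<lambda>x. iexp (t * x) / (\<i> * t)"])
      show "((\<lambda>x. iexp (t * x) / (\<i> * t)) has_vector_derivative iexp (t * x)) (at x within {a..b})" for x
        unfolding of_real_mult
        by (rule has_vector_derivative_real_field, use that in \<open>auto intro!: derivative_eq_intros simp: field_simps\<close>)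
      show "continuous_on {a..b} (\<lambda>x. iexp (t * x))" by (intro continuous_intros)
    qed
    then show ?thesis by (simp add: diff_divide_distrib)
  qed
  have "((\<lambda>t::real. 2 / \<bar>t\<bar>) \<longlongrightarrow> 0) at_infinity"
    using tendsto_mult[OF tendsto_const tendsto_norm[OF tendsto_inverse_0[where 'a = real]], of 2]
    by (simp add: divide_inverse)
  then show ?thesis
  proof (rule Lim_null_comparison[rotated])
    show "\<forall>\<^sub>F t in at_infinity. cmod (CLBINT x. indicator {a..b} x *\<^sub>R iexp (t * x)) \<le> 2 / \<bar>t\<bar>"
      unfolding eventually_at_infinity
    proof (intro exI[of _ 1] allI impI)
      fix t :: real assume "1 \<le> norm t"
      then have "t \<noteq> 0" by auto
      have "cmod (iexp (t * b) - iexp (t * a)) \<le> 1 + 1"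
        by (rule norm_triangle_le_diff) simp
      then show "cmod (CLBINT x. indicator {a..b} x *\<^sub>R iexp (t * x)) \<le> 2 / \<bar>t\<bar>"
        unfolding eq[OF \<open>t \<noteq> 0\<close>] by (simp add: norm_divide norm_mult divide_right_mono)
    qed
  qed
qed simp

text \<open>Dominated pointwise convergence gives convergence in L1, and since \<open>iexp\<close>
  has modulus 1 the L1 distance bounds the distance of the transforms uniformly in \<open>t\<close>.
  This closure property serves countable unions, truncations and the final passage to integrable
  functions.\<close>

lemma iexp_transform_tendsto_0_limit:
  fixes f :: "real \<Rightarrow> complex" and s :: "nat \<Rightarrow> real \<Rightarrow> complex"
  assumes s: "\<And>i. integrable lborel (s i)"
    and s0: "\<And>i. ((\<lambda>t. CLBINT x. s i x * iexp (t * x)) \<longlongrightarrow> 0) at_infinity"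
    and lim: "\<And>x. (\<lambda>i. s i x) \<longlonglongrightarrow> f x"
    and le: "\<And>i x. norm (s i x) \<le> w x"
    and w: "integrable lborel w"
  shows "((\<lambda>t. CLBINT x. f x * iexp (t * x)) \<longlongrightarrow> 0) at_infinity"
proof -
  have [measurable]: "s i \<in> borel_measurable borel" for i using s[of i] by simp
  have [measurable]: "f \<in> borel_measurable borel"
    by (rule borel_measurable_LIMSEQ_metric[OF _ lim]) measurable
  have f: "integrable lborel f"
    by (rule integrable_dominated_convergence[OF _ _ w, of _ s]) (use lim le in auto)
  have nf: "norm (f x) \<le> w x" for x
    by (rule LIMSEQ_le_const2[OF tendsto_norm[OF lim]]) (use le in auto)
  have "(\<lambda>i. LBINT x. norm (f x - s i x)) \<longlonglongrightarrow> (LBINT x::real. 0)"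
  proof (rule integral_dominated_convergence[where w = "\<lambda>x. 2 * w x"])
    show "AE x in lborel. (\<lambda>i. norm (f x - s i x)) \<longlonglongrightarrow> 0"
      using tendsto_norm_zero[OF LIM_zero[OF lim]] by (simp add: norm_minus_commute)
    show "AE x in lborel. norm (norm (f x - s i x)) \<le> 2 * w x" for i
    proof (intro AE_I2)
      fix x show "norm (norm (f x - s i x)) \<le> 2 * w x"
        using norm_triangle_ineq4[of "f x" "s i x"] nf[of x] le[of i x] by simp
    qed
  qed (use w in auto)
  then have L1: "(\<lambda>i. LBINT x. norm (f x - s i x)) \<longlonglongrightarrow> 0" by simp
  show ?thesis
  proof (rule tendstoI)
    fix e :: real assume "0 < e"
    \<comment> \<open>The index is fixed before \<open>t\<close>, because this bound on the error
      does not involve \<open>t\<close>.\<close>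
    then obtain i where i: "(LBINT x. norm (f x - s i x)) < e / 2"
      using order_tendstoD(2)[OF L1, of "e / 2"] by (auto simp: eventually_sequentially)
    have "\<forall>\<^sub>F t in at_infinity. dist (CLBINT x. s i x * iexp (t * x)) 0 < e / 2"
      using \<open>0 < e\<close> by (intro tendstoD[OF s0]) auto
    then show "\<forall>\<^sub>F t in at_infinity. dist (CLBINT x. f x * iexp (t * x)) 0 < e"
    proof eventually_elim
      case (elim t)
      have int: "integrable lborel (\<lambda>x. g x * iexp (t * x))" if "integrable lborel g" for g
        by (rule Bochner_Integration.integrable_bound[OF that]) (use that in \<open>auto simp: norm_mult\<close>)
      have "(CLBINT x. f x * iexp (t * x)) =
          (CLBINT x. (f x - s i x) * iexp (t * x)) + (CLBINT x. s i x * iexp (t * x))"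
        unfolding left_diff_distrib
        by (subst Bochner_Integration.integral_diff[OF int[OF f] int[OF s]]) simp
      moreover have "norm (CLBINT x. (f x - s i x) * iexp (t * x)) \<le> (LBINT x. norm (f x - s i x))"
        by (rule order_trans[OF integral_norm_bound]) (simp add: norm_mult)
      ultimately show ?case
        using i elim norm_triangle_ineq[of "CLBINT x. (f x - s i x) * iexp (t * x)" "CLBINT x. s i x * iexp (t * x)"]
        by simp
    qed
  qed
qed


lemma iexp_transform_tendsto_0_add:
  fixes f g :: "real \<Rightarrow> complex"
  assumes f: "integrable lborel f" "((\<lambda>t. CLBINT x. f x * iexp (t * x)) \<longlongrightarrow> 0) at_infinity"
    and g: "integrable lborel g" "((\<lambda>t. CLBINT x. g x * iexp (t * x)) \<longlongrightarrow> 0) at_infinity"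
  shows "((\<lambda>t. CLBINT x. (f x + g x) * iexp (t * x)) \<longlongrightarrow> 0) at_infinity"
proof -
  have int: "integrable lborel (\<lambda>x. h x * iexp (t * x))" if "integrable lborel h" for h t
    by (rule Bochner_Integration.integrable_bound[OF that]) (use that in \<open>auto simp: norm_mult\<close>)
  show ?thesis
    using tendsto_add[OF f(2) g(2)]
    unfolding distrib_right Bochner_Integration.integral_add[OF int[OF f(1)] int[OF g(1)]] by simp
qed

lemma integrable_indicator_Icc:
  fixes a b :: real
  assumes [measurable]: "A \<in> sets borel"
  shows "integrable lborel (\<lambda>x. complex_of_real (indicator (A \<inter> {a..b}) x))"
proof -
  have "emeasure lborel (A \<inter> {a..b}) \<le> emeasure lborel (cbox a b)" by (rule emeasure_mono) auto
  also have "\<dots> < \<infinity>" by (rule emeasure_lborel_cbox_finite)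
  finally show ?thesis by auto
qed

text \<open>Induction over the Borel sets as a Dynkin system generated by the intervals. The window
  \<open>{a..b}\<close> keeps all indicators integrable, so that a complement becomes the difference
  of two integrable functions.\<close>

lemma indicator_iexp_transform_tendsto_0:
  fixes A :: "real set" and a b :: real
  assumes "A \<in> sets borel"
  shows "((\<lambda>t. CLBINT x. of_real (indicator (A \<inter> {a..b}) x) * iexp (t * x)) \<longlongrightarrow> 0) at_infinity"
  using assms
proof (induction rule: borel_set_induct)
  case (interval c d)
  show ?case
    using integral_iexp_interval_tendsto_0[of "max c a" "min d b"]
    by (simp add: Int_atLeastAtMost scaleR_conv_of_real)
next
  case (compl A)
  note [measurable] = compl.hyps
  have "((\<lambda>t. CLBINT x. - of_real (indicator (A \<inter> {a..b}) x) * iexp (t * x)) \<longlongrightarrow> 0) at_infinity"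
    using tendsto_minus[OF compl.IH] by simp
  moreover have "((\<lambda>t. CLBINT x. of_real (indicator (UNIV \<inter> {a..b}) x) * iexp (t * x)) \<longlongrightarrow> 0) at_infinity"
    using integral_iexp_interval_tendsto_0[of a b] by (simp add: scaleR_conv_of_real)
  ultimately have "((\<lambda>t. CLBINT x. (of_real (indicator (UNIV \<inter> {a..b}) x) +
      - of_real (indicator (A \<inter> {a..b}) x)) * iexp (t * x)) \<longlongrightarrow> 0) at_infinity"
    using integrable_indicator_Icc[of UNIV a b] integrable_indicator_Icc[of A a b]
    by (intro iexp_transform_tendsto_0_add) auto
  moreover have "of_real (indicator (UNIV \<inter> {a..b}) x) + - of_real (indicator (A \<inter> {a..b}) x) =
      complex_of_real (indicator (- A \<inter> {a..b}) x)" for x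
    by (auto split: split_indicator)
  ultimately show ?case by (simp only:)
next
  case (union F)
  have [measurable]: "F i \<in> sets borel" for i by (rule union)
  have fin: "((\<lambda>t. CLBINT x. of_real (indicator ((\<Union>i<n. F i) \<inter> {a..b}) x) * iexp (t * x)) \<longlongrightarrow> 0) at_infinity" for n
  proof (induction n)
    case (Suc n)
    \<comment> \<open>Disjointness is what makes the indicators of the partial unions add
      up.\<close>
    have "x \<notin> F n" if "x \<in> F i" "i < n" for x i
      using that disjoint_family_onD[OF union.hyps(1), of i n] by auto
    then have eq: "of_real (indicator ((\<Union>i<Suc n. F i) \<inter> {a..b}) x) =
        complex_of_real (indicator ((\<Union>i<n. F i) \<inter> {a..b}) x) + of_real (indicator (F n \<inter> {a..b}) x)" for x
      by (auto simp: lessThan_Suc split: split_indicator)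
    show ?case
      unfolding eq by (intro iexp_transform_tendsto_0_add integrable_indicator_Icc Suc union) measurable
  qed simp
  show ?case
  proof (rule iexp_transform_tendsto_0_limit[where w = "indicator {a..b}"])
    show "integrable lborel (\<lambda>x. complex_of_real (indicator ((\<Union>i<n. F i) \<inter> {a..b}) x))" for n
      by (intro integrable_indicator_Icc) measurable
    show "(\<lambda>n. complex_of_real (indicator ((\<Union>i<n. F i) \<inter> {a..b}) x)) \<longlonglongrightarrow>
        of_real (indicator ((\<Union>i. F i) \<inter> {a..b}) x)" for x
    proof (rule tendsto_of_real)
      have "(\<lambda>n. indicator (\<Union>i<n. F i) x :: real) \<longlonglongrightarrow> indicator (\<Union>i. F i) x"
        by (rule LIMSEQ_indicator_UN)
      from tendsto_mult[OF this tendsto_const[of "indicator {a..b} x"]]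
      show "(\<lambda>n. indicator ((\<Union>i<n. F i) \<inter> {a..b}) x :: real) \<longlonglongrightarrow> indicator ((\<Union>i. F i) \<inter> {a..b}) x"
        by (simp only: indicator_inter_arith)
    qed
    show "norm (complex_of_real (indicator ((\<Union>i<n. F i) \<inter> {a..b}) x)) \<le> indicator {a..b} x" for n x
      by (auto split: split_indicator)
    show "integrable lborel (indicator {a..b} :: real \<Rightarrow> real)"
      by (rule integrable_real_indicator) (use emeasure_lborel_cbox_finite[of a b] in auto)
  qed (rule fin)
qed simp

lemma Riemann_Lebesgue:
  fixes f :: "real \<Rightarrow> complex"
  assumes "integrable lborel f"
  shows "((\<lambda>t. CLBINT x. f x * iexp (t * x)) \<longlongrightarrow> 0) at_infinity"
  using assms
proof (induction rule: integrable_induct)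
  case (base A c)
  then have [measurable]: "A \<in> sets borel" by simp
  have "((\<lambda>t. CLBINT x. of_real (indicator A x) * iexp (t * x)) \<longlongrightarrow> 0) at_infinity"
  proof (rule iexp_transform_tendsto_0_limit)
    \<comment> \<open>Growing windows remove the truncation; the finite measure of \<open>A\<close>
      makes its own indicator the dominating function.\<close>
    show "((\<lambda>t. CLBINT x. of_real (indicator (A \<inter> {-real n..real n}) x) * iexp (t * x)) \<longlongrightarrow> 0) at_infinity" for n
      by (rule indicator_iexp_transform_tendsto_0) measurable
    show "integrable lborel (\<lambda>x. complex_of_real (indicator (A \<inter> {-real n..real n}) x))" for n
    proof -
      have "emeasure lborel (A \<inter> {-real n..real n}) \<le> emeasure lborel A" by (rule emeasure_mono) auto
      also have "\<dots> < \<infinity>" using base by simp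
      finally show ?thesis by (auto intro!: integrable_of_real integrable_real_indicator)
    qed
    show "integrable lborel (indicator A :: real \<Rightarrow> real)"
      using base by (intro integrable_real_indicator) auto
    show "norm (complex_of_real (indicator (A \<inter> {-real n..real n}) x)) \<le> indicator A x" for n x
      by (auto split: split_indicator)
    show "(\<lambda>n. complex_of_real (indicator (A \<inter> {-real n..real n}) x)) \<longlonglongrightarrow> of_real (indicator A x)" for x
    proof (rule tendsto_eventually)
      obtain N where N: "\<bar>x\<bar> \<le> real N" using real_arch_simple by blast
      show "\<forall>\<^sub>F n in sequentially. complex_of_real (indicator (A \<inter> {-real n..real n}) x) = of_real (indicator A x)"
        using eventually_ge_at_top[of N]
      proof eventually_elim
        case (elim n)
        then have "x \<in> {-real n..real n}" using N by (auto simp: abs_le_iff)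
        then show ?case by (auto split: split_indicator)
      qed
    qed
  qed
  from tendsto_mult[OF tendsto_const[of c] this] show ?case
    by (simp add: scaleR_conv_of_real mult.assoc mult.left_commute)
next
  case (add f g)
  then show ?case by (intro iexp_transform_tendsto_0_add)
next
  case (lim f s)
  show ?case
  proof (rule iexp_transform_tendsto_0_limit[where s = s])
    show "integrable lborel (\<lambda>x. 2 * norm (f x))" using lim(4) by auto
  qed (use lim in simp_all)
qed

section \<open>Riemann-Lebesgue for weighted laws of random variables\<close>

text \<open>The hypothesis \<open>ac\<close> says that the image under \<open>Z\<close> of the
  finite measure with density \<open>W\<close> is absolutely continuous. Its Radon-Nikodym
  derivative is an integrable function whose transform is the integral in question.\<close>

lemma weighted_Riemann_Lebesgue_nonneg:
  fixes W Z :: "'s \<Rightarrow> real"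
  assumes W: "integrable M W" "\<And>\<omega>. 0 \<le> W \<omega>"
    and Z [measurable]: "Z \<in> borel_measurable M"
    and ac: "\<And>N. N \<in> null_sets lborel \<Longrightarrow> AE \<omega> in M. Z \<omega> \<in> N \<longrightarrow> W \<omega> = 0"
  shows "((\<lambda>t. CLINT \<omega>|M. of_real (W \<omega>) * iexp (t * Z \<omega>)) \<longlongrightarrow> 0) at_infinity"
proof -
  have [measurable]: "W \<in> borel_measurable M" using W by simp
  define D where "D = density M (\<lambda>\<omega>. ennreal (W \<omega>))"
  define \<nu> where "\<nu> = distr D borel Z"
  have [measurable]: "Z \<in> borel_measurable D" by (simp add: D_def)
  have "emeasure D (space D) = \<integral>\<^sup>+\<omega>. ennreal (W \<omega>) \<partial>M"
    unfolding D_def by (subst emeasure_density) (auto intro!: nn_integral_cong)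
  also have "\<dots> = ennreal (LINT \<omega>|M. W \<omega>)"
    using W by (intro nn_integral_eq_integral) auto
  finally have "finite_measure D" by (intro finite_measureI) simp
  then have fin: "finite_measure \<nu>"
    unfolding \<nu>_def by (intro finite_measure.finite_measure_distr) auto
  have "absolutely_continuous lborel \<nu>"
    unfolding absolutely_continuous_def
  proof
    fix N assume N: "N \<in> null_sets (lborel :: real measure)"
    then have [measurable]: "N \<in> sets borel" by auto
    have "emeasure \<nu> N = (\<integral>\<^sup>+\<omega>. ennreal (W \<omega>) * indicator (Z -` N \<inter> space M) \<omega> \<partial>M)"
      unfolding \<nu>_def by (simp add: emeasure_distr) (simp add: D_def emeasure_density)
    also have "\<dots> = (\<integral>\<^sup>+\<omega>. 0 \<partial>M)"
      by (rule nn_integral_cong_AE, use ac[OF N] in eventually_elim) (auto split: split_indicator)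
    finally show "N \<in> null_sets \<nu>" by (simp add: null_sets_def \<nu>_def)
  qed
  moreover have "sets \<nu> = sets lborel" by (simp add: \<nu>_def)
  ultimately obtain f where f: "f \<in> borel_measurable lborel"
      "AE x in lborel. RN_deriv lborel \<nu> x = ennreal (f x)" "\<And>x. 0 \<le> f x"
    and \<nu>: "density lborel (RN_deriv lborel \<nu>) = \<nu>"
    using sigma_finite_measure.real_RN_deriv[OF lborel.sigma_finite_measure_axioms fin]
      sigma_finite_measure.density_RN_deriv[OF lborel.sigma_finite_measure_axioms] by metis
  have [measurable]: "f \<in> borel_measurable borel" using f(1) by simp
  have "density lborel (RN_deriv lborel \<nu>) = density lborel (\<lambda>x. ennreal (f x))"
    by (rule density_cong) (use f in auto)
  with \<nu> have \<nu>_eq: "\<nu> = density lborel (\<lambda>x. ennreal (f x))" by simp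
  have "integrable \<nu> (\<lambda>x. 1 :: real)"
    using fin by (rule finite_measure.integrable_const)
  then have "integrable lborel f"
    unfolding \<nu>_eq by (subst (asm) integrable_density) (use f(3) in auto)
  then have "((\<lambda>t. CLBINT x. of_real (f x) * iexp (t * x)) \<longlongrightarrow> 0) at_infinity"
    by (intro Riemann_Lebesgue integrable_of_real)
  moreover have "(CLINT \<omega>|M. of_real (W \<omega>) * iexp (t * Z \<omega>)) = (CLBINT x. of_real (f x) * iexp (t * x))" for t
  proof -
    have "(CLINT \<omega>|M. of_real (W \<omega>) * iexp (t * Z \<omega>)) = (CLINT \<omega>|D. iexp (t * Z \<omega>))"
      unfolding D_def by (subst integral_density) (use W in \<open>auto simp: scaleR_conv_of_real\<close>)
    also have "\<dots> = (CLINT x|\<nu>. iexp (t * x))"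
      unfolding \<nu>_def by (subst integral_distr) auto
    also have "\<dots> = (CLBINT x. of_real (f x) * iexp (t * x))"
      unfolding \<nu>_eq by (subst integral_density) (use f(3) in \<open>auto simp: scaleR_conv_of_real\<close>)
    finally show ?thesis .
  qed
  ultimately show ?thesis by (simp only:)
qed

lemma weighted_Riemann_Lebesgue:
  fixes W :: "'s \<Rightarrow> complex" and Z :: "'s \<Rightarrow> real"
  assumes W: "integrable M W"
    and Z [measurable]: "Z \<in> borel_measurable M"
    and ac: "\<And>N. N \<in> null_sets lborel \<Longrightarrow> AE \<omega> in M. Z \<omega> \<in> N \<longrightarrow> W \<omega> = 0"
  shows "((\<lambda>t. CLINT \<omega>|M. W \<omega> * iexp (t * Z \<omega>)) \<longlongrightarrow> 0) at_infinity"
proof -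
  have [measurable]: "W \<in> borel_measurable M" using W by simp
  \<comment> \<open>With \<open>g\<close> ranging over \<open>Re\<close>, \<open>Im\<close> and
    their negatives, these are the positive and negative parts of both components. Each vanishes
    where \<open>W\<close> does and so inherits \<open>ac\<close>.\<close>
  define part where "part g \<omega> = max 0 (g (W \<omega>))" for g :: "complex \<Rightarrow> real" and \<omega>
  have part: "integrable M (part g)"
      "((\<lambda>t. CLINT \<omega>|M. of_real (part g \<omega>) * iexp (t * Z \<omega>)) \<longlongrightarrow> 0) at_infinity"
    if "g \<in> {Re, Im, \<lambda>z. - Re z, \<lambda>z. - Im z}" for g
  proof -
    show int: "integrable M (part g)"
      unfolding part_def by (intro integrable_max) (use that W in auto)
    have "AE \<omega> in M. Z \<omega> \<in> N \<longrightarrow> part g \<omega> = 0" if "N \<in> null_sets lborel" for N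
      using ac[OF that] by eventually_elim (use \<open>g \<in> _\<close> in \<open>auto simp: part_def\<close>)
    then show "((\<lambda>t. CLINT \<omega>|M. of_real (part g \<omega>) * iexp (t * Z \<omega>)) \<longlongrightarrow> 0) at_infinity"
      by (intro weighted_Riemann_Lebesgue_nonneg int Z) (auto simp: part_def)
  qed
  have int: "integrable M (\<lambda>\<omega>. of_real (part g \<omega>) * iexp (t * Z \<omega>))"
    if "g \<in> {Re, Im, \<lambda>z. - Re z, \<lambda>z. - Im z}" for g t
    by (rule Bochner_Integration.integrable_bound[OF part(1)[OF that]])
      (use part(1)[OF that] in \<open>auto simp: norm_mult\<close>)
  let ?I = "\<lambda>g t. CLINT \<omega>|M. of_real (part g \<omega>) * iexp (t * Z \<omega>)"
  have decomp: "W \<omega> * e = (of_real (part Re \<omega>) * e - of_real (part (\<lambda>z. - Re z) \<omega>) * e) +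
      \<i> * (of_real (part Im \<omega>) * e - of_real (part (\<lambda>z. - Im z) \<omega>) * e)" for \<omega> e
  proof -
    have "W \<omega> = (of_real (part Re \<omega>) - of_real (part (\<lambda>z. - Re z) \<omega>)) +
        \<i> * (of_real (part Im \<omega>) - of_real (part (\<lambda>z. - Im z) \<omega>))"
      by (auto simp: part_def complex_eq_iff max_def)
    from arg_cong[where f = "\<lambda>z. z * e", OF this] show ?thesis
      by (simp only: distrib_right left_diff_distrib mult.assoc)
  qed
  have "(CLINT \<omega>|M. W \<omega> * iexp (t * Z \<omega>)) =
      (?I Re t - ?I (\<lambda>z. - Re z) t) + \<i> * (?I Im t - ?I (\<lambda>z. - Im z) t)" for t
    unfolding decomp
    by (subst Bochner_Integration.integral_add Bochner_Integration.integral_diff integral_mult_right_zero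
        | (intro Bochner_Integration.integrable_diff integrable_mult_right int; simp))+ simp
  moreover have "((\<lambda>t. (?I Re t - ?I (\<lambda>z. - Re z) t) + \<i> * (?I Im t - ?I (\<lambda>z. - Im z) t)) \<longlongrightarrow>
      (0 - 0) + \<i> * (0 - 0)) at_infinity"
    by (intro tendsto_intros part(2)) auto
  ultimately show ?thesis by simp
qed

section \<open>Linear functionals of laws in the class\<close>

lemma null_sets_affine_vimage:
  fixes a b :: real
  assumes N: "N \<in> null_sets lborel" and "a \<noteq> 0"
  shows "(\<lambda>x. b + a * x) -` N \<in> null_sets lborel"
proof -
  have [measurable]: "N \<in> sets borel" using N by auto
  have "AE x in lborel. x \<notin> N" using N by (rule AE_not_in)
  then have "AE x in lborel. b + a * x \<notin> N"
    using AE_borel_affine[OF \<open>a \<noteq> 0\<close>, of "\<lambda>x. x \<notin> N" b] by simp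
  moreover have "(\<lambda>x. b + a * x) -` N \<inter> space borel \<in> sets borel" by measurable
  ultimately show ?thesis
    by (subst AE_iff_null_sets) auto
qed

lemma sets_functional_vimage:
  fixes a b :: real
  assumes "N \<in> sets borel"
  shows "(\<lambda>(x, y). a * x + b * y) -` N \<in> sets borel"
proof -
  have "(\<lambda>(x, y). a * x + b * y) \<in> borel_measurable (borel :: (real \<times> real) measure)"
    unfolding case_prod_beta' by (intro borel_measurable_continuous_onI continuous_intros)
  from measurable_sets[OF this assms] show ?thesis by simp
qed

text \<open>By Fubini, slicing along a coordinate with nonzero coefficient: every slice is the
  preimage of \<open>N\<close> under a nonconstant affine map of the line.\<close>

lemma null_sets_functional_vimage:
  fixes a b :: real
  assumes N: "N \<in> null_sets lborel" and ab: "a \<noteq> 0 \<or> b \<noteq> 0"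
  shows "(\<lambda>(x, y). a * x + b * y) -` N \<in> null_sets (lborel :: (real \<times> real) measure)"
proof -
  have [measurable]: "N \<in> sets borel" using N by auto
  let ?S = "(\<lambda>(x, y). a * x + b * y) -` N"
  have S': "?S \<in> sets borel" using N by (intro sets_functional_vimage) auto
  then have S: "?S \<in> sets (lborel \<Otimes>\<^sub>M lborel)" unfolding lborel_prod by simp
  have "emeasure (lborel \<Otimes>\<^sub>M lborel) ?S = 0"
  proof (cases "b = 0")
    case False
    have "Pair x -` ?S = (\<lambda>y. a * x + b * y) -` N" for x by auto
    then have "emeasure lborel (Pair x -` ?S) = 0" for x
      using null_sets_affine_vimage[OF N False, of "a * x"] by auto
    then show ?thesis using S by (subst lborel.emeasure_pair_measure_alt) auto
  next
    case True
    have "(\<lambda>x. (x, y)) -` ?S = (\<lambda>x. b * y + a * x) -` N" for y by (auto simp: add.commute)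
    then have "emeasure lborel ((\<lambda>x. (x, y)) -` ?S) = 0" for y
      using null_sets_affine_vimage[OF N, of a "b * y"] True ab by auto
    then show ?thesis using S by (subst lborel_pair.emeasure_pair_measure_alt2) auto
  qed
  then show ?thesis using S' by (simp add: null_sets_def lborel_prod)
qed

lemma class_D_functional_ac:
  fixes \<mu> :: "(real \<times> real) measure" and a b :: real
  assumes D: "class_D \<mu>" and N: "N \<in> null_sets lborel" "0 \<notin> N"
  shows "(\<lambda>(x, y). a * x + b * y) -` N \<in> null_sets \<mu>"
proof -
  interpret prob_space \<mu> using D by (simp add: class_D_def)
  have [measurable]: "N \<in> sets borel" using N by auto
  let ?S = "(\<lambda>(x, y). a * x + b * y) -` N"
  have S: "?S \<in> sets borel" by (intro sets_functional_vimage) measurable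
  obtain n :: nat and c :: "nat \<Rightarrow> real" and A :: "nat \<Rightarrow> real \<times> real \<Rightarrow> real \<times> real" and \<nu>
    where *: "\<forall>j<n. 0 \<le> c j \<and> linear (A j) \<and> spd_law (\<nu> j)"
      and sum: "\<forall>E\<in>sets borel. measure \<mu> E = (\<Sum>j<n. c j * measure (\<nu> j) (A j -` E))"
    using D unfolding class_D_def by (elim conjE exE) (rule that)
  note eq = sum[rule_format, OF S]
  have "measure (\<nu> j) (A j -` ?S) = 0" if j: "j < n" for j
  proof -
    interpret L: linear "A j" using * j by blast
    \<comment> \<open>The functional with coefficients \<open>(a, b)\<close> pulled back along
      \<open>A j\<close>: \<open>(r, s)\<close> is the transpose of \<open>A j\<close> applied to
      \<open>(a, b)\<close>.\<close>
    define r s where "r = a * fst (A j (1, 0)) + b * snd (A j (1, 0))"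
      and "s = a * fst (A j (0, 1)) + b * snd (A j (0, 1))"
    have "a * fst (A j p) + b * snd (A j p) = r * fst p + s * snd p" for p
    proof -
      have "A j p = A j (fst p *\<^sub>R (1, 0) + snd p *\<^sub>R (0, 1))" by (simp add: prod_eq_iff)
      also have "\<dots> = fst p *\<^sub>R A j (1, 0) + snd p *\<^sub>R A j (0, 1)"
        by (simp only: L.scaleR L.add)
      finally have p: "A j p = fst p *\<^sub>R A j (1, 0) + snd p *\<^sub>R A j (0, 1)" .
      show ?thesis unfolding r_def s_def by (subst (1 2) p) (simp add: algebra_simps)
    qed
    then have rs: "A j -` ?S = (\<lambda>(x, y). r * x + s * y) -` N"
      unfolding vimage_def case_prod_unfold by simp
    show ?thesis
    proof (cases "r = 0 \<and> s = 0")
      case True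
      \<comment> \<open>The pulled-back functional is identically 0, and 0 is not in
        \<open>N\<close>.\<close>
      then have "A j -` ?S = {}" unfolding rs using N(2) by auto
      then show ?thesis by simp
    next
      case False
      obtain f where f: "f \<in> borel_measurable borel" "\<nu> j = density lborel (\<lambda>x. ennreal (f x))"
        using *[rule_format, OF j] unfolding spd_law_def by blast
      have "A j -` ?S \<in> null_sets lborel"
        unfolding rs using False by (intro null_sets_functional_vimage N) auto
      then have "A j -` ?S \<in> null_sets (\<nu> j)"
        unfolding f(2) using f(1) by (subst null_sets_density_iff) (auto dest: AE_not_in elim!: eventually_mono)
      then show ?thesis by (simp add: null_sets_def measure_def)
    qed
  qed
  then have "measure \<mu> ?S = 0" by (simp add: eq)
  then show ?thesis using S D by (auto simp: null_sets_def emeasure_eq_measure class_D_def)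
qed

section \<open>Limits of characteristic functions and codifferences\<close>

text \<open>The value stays complex, since splitting over selectors and the tail limits are
  statements about complex integrals; the real part enters only when logarithms are taken.\<close>

definition chf :: "'s measure \<Rightarrow> real \<Rightarrow> ('s \<Rightarrow> real) \<Rightarrow> complex" where
  "chf M \<theta> X = (CLINT \<omega>|M. iexp (\<theta> * X \<omega>))"

lemma log_char_chf: "log_char M \<theta> X = - (2 / \<theta>\<^sup>2) * ln (Re (chf M \<theta> X))"
  by (simp add: log_char_def chf_def)

text \<open>Positivity at the limit suffices, as \<open>ln\<close> is continuous there; the factor
  \<open>r\<close> turns into an additive shift.\<close>

lemma log_char_tendsto:
  assumes "((\<lambda>w. chf M \<theta> (X w)) \<longlongrightarrow> of_real r * chf M \<theta> Y) F" "0 < r" "0 < Re (chf M \<theta> Y)"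
  shows "((\<lambda>w. log_char M \<theta> (X w)) \<longlongrightarrow> log_char M \<theta> Y - 2 / \<theta>\<^sup>2 * ln r) F"
proof -
  have "((\<lambda>w. Re (chf M \<theta> (X w))) \<longlongrightarrow> r * Re (chf M \<theta> Y)) F"
    using tendsto_Re[OF assms(1)] by simp
  then have "((\<lambda>w. - (2 / \<theta>\<^sup>2) * ln (Re (chf M \<theta> (X w)))) \<longlongrightarrow> - (2 / \<theta>\<^sup>2) * ln (r * Re (chf M \<theta> Y))) F"
    using assms by (intro tendsto_intros) auto
  then show ?thesis
    unfolding log_char_chf
    by (rule tendsto_eq_rhs) (use assms in \<open>simp add: ln_mult algebra_simps add_divide_distrib\<close>)
qed

text \<open>The two joint terms are both shifted by a multiple of \<open>ln (a * b)\<close>, which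
  cancels in the symmetric codifference. In the asymmetric ones it cancels against the shifts of the
  two marginals, because the joint factor is the product of the marginal factors. A variable that is
  not decomposed has factor 1.\<close>

lemma codiff_tendsto:
  assumes c: "c \<in> {sym_codiff M \<theta>, asym_codiff_plus M \<theta>, asym_codiff_minus M \<theta>}"
    and ab: "0 < a" "0 < b"
    and X: "((\<lambda>w. chf M \<theta> (Xs w)) \<longlongrightarrow> of_real a * chf M \<theta> X) F" "0 < Re (chf M \<theta> X)"
    and Y: "((\<lambda>w. chf M \<theta> (Ys w)) \<longlongrightarrow> of_real b * chf M \<theta> Y) F" "0 < Re (chf M \<theta> Y)"
    and XY: "\<And>s. s \<in> {1, -1} \<Longrightarrow> ((\<lambda>w. chf M \<theta> (\<lambda>\<omega>. Xs w \<omega> + s * Ys w \<omega>)) \<longlongrightarrow>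
        of_real (a * b) * chf M \<theta> (\<lambda>\<omega>. X \<omega> + s * Y \<omega>)) F"
      "\<And>s. s \<in> {1, -1} \<Longrightarrow> 0 < Re (chf M \<theta> (\<lambda>\<omega>. X \<omega> + s * Y \<omega>))"
  shows "((\<lambda>w. c (Xs w) (Ys w)) \<longlongrightarrow> c X Y) F"
proof -
  define k where "k = 2 / \<theta>\<^sup>2"
  have ln: "ln (a * b) = ln a + ln b" using ab by (simp add: ln_mult)
  have ab': "0 < a * b" using ab by simp
  note lX = log_char_tendsto[OF X(1) ab(1) X(2), folded k_def]
  note lY = log_char_tendsto[OF Y(1) ab(2) Y(2), folded k_def]
  have lP: "((\<lambda>w. log_char M \<theta> (\<lambda>\<omega>. Xs w \<omega> + Ys w \<omega>)) \<longlongrightarrow>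
      log_char M \<theta> (\<lambda>\<omega>. X \<omega> + Y \<omega>) - k * (ln a + ln b)) F"
    using log_char_tendsto[OF XY(1) ab' XY(2), of 1, folded k_def] by (simp add: ln)
  have lM: "((\<lambda>w. log_char M \<theta> (\<lambda>\<omega>. Xs w \<omega> - Ys w \<omega>)) \<longlongrightarrow>
      log_char M \<theta> (\<lambda>\<omega>. X \<omega> - Y \<omega>) - k * (ln a + ln b)) F"
    using log_char_tendsto[OF XY(1) ab' XY(2), of "-1", folded k_def] by (simp add: ln)
  have "((\<lambda>w. sym_codiff M \<theta> (Xs w) (Ys w)) \<longlongrightarrow> sym_codiff M \<theta> X Y) F"
    unfolding sym_codiff_def by (rule tendsto_eq_rhs[OF tendsto_mult[OF tendsto_const tendsto_diff[OF lP lM]]]) simp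
  moreover have "((\<lambda>w. asym_codiff_plus M \<theta> (Xs w) (Ys w)) \<longlongrightarrow> asym_codiff_plus M \<theta> X Y) F"
    unfolding asym_codiff_plus_def
    by (rule tendsto_eq_rhs[OF tendsto_mult[OF tendsto_const tendsto_diff[OF tendsto_add[OF lX lY] lM]]])
      (simp add: distrib_left)
  moreover have "((\<lambda>w. asym_codiff_minus M \<theta> (Xs w) (Ys w)) \<longlongrightarrow> asym_codiff_minus M \<theta> X Y) F"
    unfolding asym_codiff_minus_def
    by (rule tendsto_eq_rhs[OF tendsto_mult[OF tendsto_const tendsto_diff[OF tendsto_add[OF lX lY] lP]]])
      (simp add: field_simps)
  ultimately show ?thesis using c by auto
qed

section \<open>Positivity and absolute continuity drawn from membership in the class\<close>

text \<open>The joint characteristic function at the vector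
  \<open>(\<theta> * a, \<theta> * b)\<close> is that of the linear combination at
  \<open>\<theta>\<close>.\<close>

lemma chf_pos_of_pair_in_D:
  assumes D: "pair_in_D M X Y" and [measurable]: "X \<in> borel_measurable M" "Y \<in> borel_measurable M"
  shows "0 < Re (chf M \<theta> (\<lambda>\<omega>. a * X \<omega> + b * Y \<omega>))"
proof -
  have "0 < Re (CLINT x|distr M borel (\<lambda>\<omega>. (X \<omega>, Y \<omega>)). iexp ((\<theta> * a, \<theta> * b) \<bullet> x))"
    using D by (simp add: class_D_def)
  also have "(CLINT x|distr M borel (\<lambda>\<omega>. (X \<omega>, Y \<omega>)). iexp ((\<theta> * a, \<theta> * b) \<bullet> x)) =
      (CLINT \<omega>|M. iexp ((\<theta> * a, \<theta> * b) \<bullet> (X \<omega>, Y \<omega>)))"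
    by (intro integral_distr borel_measurable_Pair assms borel_measurable_continuous_onI continuous_intros)
  finally show ?thesis by (simp add: chf_def algebra_simps)
qed

lemma pair_in_D_functional_ac:
  assumes D: "pair_in_D M X Y" and [measurable]: "X \<in> borel_measurable M" "Y \<in> borel_measurable M"
    and N: "N \<in> null_sets lborel"
  shows "AE \<omega> in M. a * X \<omega> + b * Y \<omega> \<in> N \<longrightarrow> a * X \<omega> + b * Y \<omega> = 0"
proof -
  \<comment> \<open>The linear combination may have an atom at 0, so 0 is taken out of
    \<open>N\<close> and reappears as the alternative in the conclusion.\<close>
  have "N - {0} \<in> null_sets lborel" using N by (intro null_set_Diff) auto
  then have "(\<lambda>(x, y). a * x + b * y) -` (N - {0}) \<in> null_sets (distr M borel (\<lambda>\<omega>. (X \<omega>, Y \<omega>)))"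
    by (intro class_D_functional_ac[OF D]) auto
  then have "AE z in distr M borel (\<lambda>\<omega>. (X \<omega>, Y \<omega>)). z \<notin> (\<lambda>(x, y). a * x + b * y) -` (N - {0})"
    by (rule AE_not_in)
  then have "AE \<omega> in M. (X \<omega>, Y \<omega>) \<notin> (\<lambda>(x, y). a * x + b * y) -` (N - {0})"
    by (rule AE_distrD[rotated]) measurable
  then show ?thesis by eventually_elim auto
qed

text \<open>On the event \<open>P\<close> the linear combination is a scaled copy of
  \<open>T\<close>, so it passes its absolute continuity off 0 on to \<open>T\<close>, and its
  possible atom at 0 is ruled out by \<open>T\<close> being nonzero almost everywhere.\<close>

lemma tail_ac:
  assumes D: "pair_in_D M X Y" and XY: "X \<in> borel_measurable M" "Y \<in> borel_measurable M"
    and T: "AE \<omega> in M. T \<omega> \<noteq> 0" and w: "w \<noteq> 0"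
    and eq: "\<And>\<omega>. P \<omega> \<Longrightarrow> a * X \<omega> + b * Y \<omega> = w * T \<omega>"
    and N: "N \<in> null_sets lborel"
  shows "AE \<omega> in M. P \<omega> \<longrightarrow> T \<omega> \<notin> N"
proof -
  \<comment> \<open>This preimage is \<open>N\<close> dilated by \<open>w\<close>.\<close>
  have "(\<lambda>x. 0 + 1 / w * x) -` N \<in> null_sets lborel"
    using w by (intro null_sets_affine_vimage N) auto
  from pair_in_D_functional_ac[OF D XY this, of a b] T show ?thesis
    by eventually_elim (use w in \<open>auto simp: eq\<close>)
qed

section \<open>Factoring independent selectors out of integrals\<close>

text \<open>Independence says that the image under \<open>V\<close> of \<open>M\<close> restricted
  to the selected event is the law of \<open>V\<close> scaled by the probability of that event;
  \<open>g\<close> is then integrated against both.\<close>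

lemma (in prob_space) selector_indep_integral:
  fixes g :: "'v \<Rightarrow> complex"
  assumes indep: "selector_indep M B N V"
    and V [measurable]: "V \<in> measurable M N" and g [measurable]: "g \<in> borel_measurable N"
  shows "(CLINT \<omega>|M. if B \<omega> then g (V \<omega>) else 0) =
    of_real (prob {\<omega> \<in> space M. B \<omega>}) * (CLINT \<omega>|M. g (V \<omega>))"
proof -
  let ?S = "{\<omega> \<in> space M. B \<omega>}"
  have [measurable]: "?S \<in> events" using indep by (auto simp: indep_set_def indep_sets_def UNIV_bool)
  have "distr (density M (indicator ?S)) N V = density (distr M N V) (\<lambda>_. ennreal (prob ?S))"
  proof (rule measure_eqI)
    fix E assume "E \<in> sets (distr (density M (indicator ?S)) N V)"
    then have [measurable]: "E \<in> sets N" by simp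
    have "V -` E \<inter> space M \<in> sets (vimage_algebra (space M) V N)"
      by (rule in_vimage_algebra) fact
    then have "prob (?S \<inter> (V -` E \<inter> space M)) = prob ?S * prob (V -` E \<inter> space M)"
      using indep by (intro indep_setD) auto
    moreover have "emeasure (distr (density M (indicator ?S)) N V) E = emeasure M (?S \<inter> (V -` E \<inter> space M))"
      by (simp add: emeasure_distr emeasure_density indicator_inter_arith[symmetric])
    moreover have "emeasure (density (distr M N V) (\<lambda>_. ennreal (prob ?S))) E =
        ennreal (prob ?S) * emeasure M (V -` E \<inter> space M)"
      by (simp add: emeasure_density nn_integral_cmult emeasure_distr)
    ultimately show "emeasure (distr (density M (indicator ?S)) N V) E =
        emeasure (density (distr M N V) (\<lambda>_. ennreal (prob ?S))) E"
      by (simp add: emeasure_eq_measure ennreal_mult)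
  qed simp
  then have "(CLINT x|distr (density M (\<lambda>\<omega>. ennreal (indicator ?S \<omega>))) N V. g x) =
      (CLINT x|density (distr M N V) (\<lambda>_. ennreal (prob ?S)). g x)"
    by (simp add: ennreal_indicator)
  also have "(CLINT x|distr (density M (\<lambda>\<omega>. ennreal (indicator ?S \<omega>))) N V. g x) =
      (CLINT \<omega>|M. indicator ?S \<omega> *\<^sub>R g (V \<omega>))"
    by (subst integral_distr) (auto simp: integral_density)
  also have "\<dots> = (CLINT \<omega>|M. if B \<omega> then g (V \<omega>) else 0)"
    by (rule Bochner_Integration.integral_cong) auto
  also have "(CLINT x|density (distr M N V) (\<lambda>_. ennreal (prob ?S)). g x) = of_real (prob ?S) * (CLINT \<omega>|M. g (V \<omega>))"
    by (subst integral_density) (auto simp: integral_distr scaleR_conv_of_real)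
  finally show ?thesis .
qed

text \<open>This extends the factorization over \<open>B\<close> to integrands that also switch with
  \<open>C\<close>. The two case distinctions are exchanged, \<open>q\<close> is drawn out first,
  then \<open>p\<close> from the pieces free of \<open>C\<close>, and the mixture over
  \<open>C\<close> is reassembled.\<close>

lemma (in prob_space) selector_swap_integral:
  fixes G H :: "'a \<Rightarrow> complex"
  assumes [measurable]: "Measurable.pred M B" "Measurable.pred M C"
    and G: "integrable M G" and H: "integrable M H"
    and B: "(CLINT \<omega>|M. if B \<omega> then G \<omega> else 0) = p * (CLINT \<omega>|M. G \<omega>)"
      "(CLINT \<omega>|M. if B \<omega> then H \<omega> else 0) = p * (CLINT \<omega>|M. H \<omega>)"
    and C: "\<And>F. F \<in> {G, H, \<lambda>\<omega>. if B \<omega> then G \<omega> else 0, \<lambda>\<omega>. if B \<omega> then H \<omega> else 0} \<Longrightarrow>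
      (CLINT \<omega>|M. if C \<omega> then F \<omega> else 0) = q * (CLINT \<omega>|M. F \<omega>)"
  shows "(CLINT \<omega>|M. if B \<omega> then (if C \<omega> then G \<omega> else H \<omega>) else 0) =
    p * (CLINT \<omega>|M. if C \<omega> then G \<omega> else H \<omega>)"
proof -
  have int: "integrable M (\<lambda>\<omega>. if P \<omega> then F \<omega> else 0)"
    if "integrable M F" and [measurable]: "Measurable.pred M P" for F :: "'a \<Rightarrow> complex" and P
    by (rule Bochner_Integration.integrable_bound[OF that(1)]) (use that(1) in auto)
  \<comment> \<open>The complement of \<open>C\<close> is expressed by subtraction, so that only the
    factorization over \<open>C\<close> itself is required.\<close>
  have mix: "(CLINT \<omega>|M. if C \<omega> then G' \<omega> else H' \<omega>) =
      q * (CLINT \<omega>|M. G' \<omega>) + (CLINT \<omega>|M. H' \<omega>) - q * (CLINT \<omega>|M. H' \<omega>)"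
    if "integrable M G'" "integrable M H'"
      "(CLINT \<omega>|M. if C \<omega> then G' \<omega> else 0) = q * (CLINT \<omega>|M. G' \<omega>)"
      "(CLINT \<omega>|M. if C \<omega> then H' \<omega> else 0) = q * (CLINT \<omega>|M. H' \<omega>)" for G' H' :: "'a \<Rightarrow> complex"
  proof -
    have "(CLINT \<omega>|M. if C \<omega> then G' \<omega> else H' \<omega>) =
        (CLINT \<omega>|M. (if C \<omega> then G' \<omega> else 0) + H' \<omega> - (if C \<omega> then H' \<omega> else 0))"
      by (rule Bochner_Integration.integral_cong) auto
    then show ?thesis
      using that by (simp add: int)
  qed
  have "(CLINT \<omega>|M. if B \<omega> then (if C \<omega> then G \<omega> else H \<omega>) else 0) =
      (CLINT \<omega>|M. if C \<omega> then (if B \<omega> then G \<omega> else 0) else (if B \<omega> then H \<omega> else 0))"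
    by (rule Bochner_Integration.integral_cong) auto
  also have "\<dots> = q * (p * (CLINT \<omega>|M. G \<omega>)) + p * (CLINT \<omega>|M. H \<omega>) - q * (p * (CLINT \<omega>|M. H \<omega>))"
    using G H B C by (subst mix) (auto simp: int)
  also have "\<dots> = p * (CLINT \<omega>|M. if C \<omega> then G \<omega> else H \<omega>)"
    using G H C by (subst mix) (auto simp: algebra_simps)
  finally show ?thesis .
qed

section \<open>Vanishing tail terms and limits of characteristic functions\<close>

lemma (in prob_space) weighted_tail_tendsto_0:
  assumes W [measurable]: "W \<in> borel_measurable M" "\<And>\<omega>. norm (W \<omega>) \<le> (1 :: real)" and k: "k \<noteq> 0"
    and T: "T \<in> borel_measurable M"
    and ac: "\<And>N. N \<in> null_sets lborel \<Longrightarrow> AE \<omega> in M. W \<omega> \<noteq> 0 \<longrightarrow> T \<omega> \<notin> N"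
  shows "((\<lambda>w. CLINT \<omega>|M. W \<omega> * iexp (k * w * T \<omega>)) \<longlongrightarrow> 0) at_top"
proof -
  have "((\<lambda>t. CLINT \<omega>|M. W \<omega> * iexp (t * T \<omega>)) \<longlongrightarrow> 0) at_infinity"
  proof (rule weighted_Riemann_Lebesgue[OF _ T])
    show "integrable M W" using W by (intro integrable_const_bound[of _ 1]) auto
    show "AE \<omega> in M. T \<omega> \<in> N \<longrightarrow> W \<omega> = 0" if "N \<in> null_sets lborel" for N
      using ac[OF that] by eventually_elim auto
  qed
  moreover have "filterlim (\<lambda>w. k * w) at_infinity at_top"
    using k by (intro tendsto_mult_filterlim_at_infinity[of _ k] tendsto_const
      filterlim_at_top_imp_at_infinity filterlim_ident) auto
  ultimately show ?thesis by (rule filterlim_compose)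
qed

lemma (in prob_space) integrable_selected_iexp:
  assumes [measurable]: "Measurable.pred M P" "X \<in> borel_measurable M"
  shows "integrable M (\<lambda>\<omega>. if P \<omega> then iexp (X \<omega>) else 0)"
  by (rule integrable_const_bound[of _ 1]) auto

lemma (in prob_space) chf_bulk_tail_tendsto:
  assumes [measurable]: "Measurable.pred M B" "X_bulk \<in> borel_measurable M" "X_tail \<in> borel_measurable M"
      "U \<in> borel_measurable M"
    and "\<theta> \<noteq> 0" "s \<noteq> 0"
    and ac: "\<And>N. N \<in> null_sets lborel \<Longrightarrow> AE \<omega> in M. \<not> B \<omega> \<longrightarrow> X_tail \<omega> \<notin> N"
    and B: "(CLINT \<omega>|M. if B \<omega> then iexp (\<theta> * (s * X_bulk \<omega> + U \<omega>)) else 0) =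
      r * chf M \<theta> (\<lambda>\<omega>. s * X_bulk \<omega> + U \<omega>)"
  shows "((\<lambda>w. chf M \<theta> (\<lambda>\<omega>. s * bulk_tail B X_bulk X_tail w \<omega> + U \<omega>)) \<longlongrightarrow>
    r * chf M \<theta> (\<lambda>\<omega>. s * X_bulk \<omega> + U \<omega>)) at_top"
proof -
  \<comment> \<open>The part of the tail integrand that does not involve \<open>w\<close>, including
    all its dependence on \<open>U\<close>.\<close>
  let ?W = "\<lambda>\<omega>. if \<not> B \<omega> then iexp (\<theta> * U \<omega>) else 0"
  have "chf M \<theta> (\<lambda>\<omega>. s * bulk_tail B X_bulk X_tail w \<omega> + U \<omega>) =
      (CLINT \<omega>|M. if B \<omega> then iexp (\<theta> * (s * X_bulk \<omega> + U \<omega>)) else 0) +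
      (CLINT \<omega>|M. ?W \<omega> * iexp (\<theta> * s * w * X_tail \<omega>))" for w
  proof -
    have "chf M \<theta> (\<lambda>\<omega>. s * bulk_tail B X_bulk X_tail w \<omega> + U \<omega>) =
      (CLINT \<omega>|M. (if B \<omega> then iexp (\<theta> * (s * X_bulk \<omega> + U \<omega>)) else 0) +
        (if \<not> B \<omega> then iexp (\<theta> * (s * (w * X_tail \<omega>) + U \<omega>)) else 0))"
      unfolding chf_def by (rule Bochner_Integration.integral_cong) (auto simp: bulk_tail_def)
    also have "\<dots> = (CLINT \<omega>|M. if B \<omega> then iexp (\<theta> * (s * X_bulk \<omega> + U \<omega>)) else 0) +
        (CLINT \<omega>|M. if \<not> B \<omega> then iexp (\<theta> * (s * (w * X_tail \<omega>) + U \<omega>)) else 0)"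
      by (intro Bochner_Integration.integral_add integrable_selected_iexp) measurable
    also have "(CLINT \<omega>|M. if \<not> B \<omega> then iexp (\<theta> * (s * (w * X_tail \<omega>) + U \<omega>)) else 0) =
        (CLINT \<omega>|M. ?W \<omega> * iexp (\<theta> * s * w * X_tail \<omega>))"
      by (rule Bochner_Integration.integral_cong) (auto simp: exp_add[symmetric] algebra_simps)
    finally show ?thesis .
  qed
  moreover have "((\<lambda>w. CLINT \<omega>|M. ?W \<omega> * iexp (\<theta> * s * w * X_tail \<omega>)) \<longlongrightarrow> 0) at_top"
    by (rule weighted_tail_tendsto_0) (use assms in auto)
  ultimately show ?thesis
    using tendsto_add[OF tendsto_const] B by fastforce
qed

text \<open>Splitting by the two selectors gives four terms. In all but the one with both bulks,
  \<open>w\<close> multiplies \<open>Y_tail\<close>, \<open>X_tail\<close> or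
  \<open>X_tail + s * Y_tail\<close>; these correspond to the three hypotheses
  \<open>ac\<close>.\<close>

lemma (in prob_space) chf_bulk_tail_joint_tendsto:
  assumes [measurable]: "Measurable.pred M B" "Measurable.pred M C"
      "X_bulk \<in> borel_measurable M" "X_tail \<in> borel_measurable M"
      "Y_bulk \<in> borel_measurable M" "Y_tail \<in> borel_measurable M"
    and "\<theta> \<noteq> 0" "s \<noteq> 0"
    and ac: "\<And>N. N \<in> null_sets lborel \<Longrightarrow> AE \<omega> in M. \<not> B \<omega> \<longrightarrow> X_tail \<omega> \<notin> N"
      "\<And>N. N \<in> null_sets lborel \<Longrightarrow> AE \<omega> in M. \<not> C \<omega> \<longrightarrow> Y_tail \<omega> \<notin> N"
      "\<And>N. N \<in> null_sets lborel \<Longrightarrow> AE \<omega> in M. \<not> B \<omega> \<and> \<not> C \<omega> \<longrightarrow> X_tail \<omega> + s * Y_tail \<omega> \<notin> N"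
    and B: "(CLINT \<omega>|M. if B \<omega> \<and> C \<omega> then iexp (\<theta> * (X_bulk \<omega> + s * Y_bulk \<omega>)) else 0) =
      r * chf M \<theta> (\<lambda>\<omega>. X_bulk \<omega> + s * Y_bulk \<omega>)"
  shows "((\<lambda>w. chf M \<theta> (\<lambda>\<omega>. bulk_tail B X_bulk X_tail w \<omega> + s * bulk_tail C Y_bulk Y_tail w \<omega>)) \<longlongrightarrow>
    r * chf M \<theta> (\<lambda>\<omega>. X_bulk \<omega> + s * Y_bulk \<omega>)) at_top"
proof -
  let ?E = "\<lambda>P Z. CLINT \<omega>|M. if P \<omega> then iexp (\<theta> * Z \<omega>) else 0"
  let ?b = "\<lambda>\<omega>. B \<omega> \<and> \<not> C \<omega>" and ?c = "\<lambda>\<omega>. \<not> B \<omega> \<and> C \<omega>" and ?n = "\<lambda>\<omega>. \<not> B \<omega> \<and> \<not> C \<omega>"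
  have "chf M \<theta> (\<lambda>\<omega>. bulk_tail B X_bulk X_tail w \<omega> + s * bulk_tail C Y_bulk Y_tail w \<omega>) =
      ?E (\<lambda>\<omega>. B \<omega> \<and> C \<omega>) (\<lambda>\<omega>. X_bulk \<omega> + s * Y_bulk \<omega>) +
      ?E ?b (\<lambda>\<omega>. X_bulk \<omega> + s * (w * Y_tail \<omega>)) +
      ?E ?c (\<lambda>\<omega>. w * X_tail \<omega> + s * Y_bulk \<omega>) +
      ?E ?n (\<lambda>\<omega>. w * X_tail \<omega> + s * (w * Y_tail \<omega>))" for w
  proof -
    have int: "integrable M (\<lambda>\<omega>. if P \<omega> then iexp (\<theta> * Z \<omega>) else 0)"
      if [measurable]: "Measurable.pred M P" "Z \<in> borel_measurable M" for P Z
      by (rule integrable_selected_iexp) measurable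
    show ?thesis
      unfolding chf_def
      by (subst Bochner_Integration.integral_add[symmetric], (intro Bochner_Integration.integrable_add int; measurable)+)+
        (auto intro!: Bochner_Integration.integral_cong simp: bulk_tail_def)
  qed
  moreover have "((\<lambda>w. ?E ?b (\<lambda>\<omega>. X_bulk \<omega> + s * (w * Y_tail \<omega>))) \<longlongrightarrow> 0) at_top"
  proof -
    have "((\<lambda>w. CLINT \<omega>|M. (if ?b \<omega> then iexp (\<theta> * X_bulk \<omega>) else 0) * iexp (\<theta> * s * w * Y_tail \<omega>)) \<longlongrightarrow> 0) at_top"
      by (rule weighted_tail_tendsto_0) (use assms(7,8) in \<open>auto intro: eventually_mono[OF ac(2)]\<close>)
    also have "(\<lambda>w. CLINT \<omega>|M. (if ?b \<omega> then iexp (\<theta> * X_bulk \<omega>) else 0) * iexp (\<theta> * s * w * Y_tail \<omega>)) =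
        (\<lambda>w. ?E ?b (\<lambda>\<omega>. X_bulk \<omega> + s * (w * Y_tail \<omega>)))"
      by (intro ext Bochner_Integration.integral_cong) (auto simp: exp_add[symmetric] algebra_simps)
    finally show ?thesis .
  qed
  moreover have "((\<lambda>w. ?E ?c (\<lambda>\<omega>. w * X_tail \<omega> + s * Y_bulk \<omega>)) \<longlongrightarrow> 0) at_top"
  proof -
    have "((\<lambda>w. CLINT \<omega>|M. (if ?c \<omega> then iexp (\<theta> * (s * Y_bulk \<omega>)) else 0) * iexp (\<theta> * w * X_tail \<omega>)) \<longlongrightarrow> 0) at_top"
      by (rule weighted_tail_tendsto_0) (use assms(7,8) in \<open>auto intro: eventually_mono[OF ac(1)]\<close>)
    also have "(\<lambda>w. CLINT \<omega>|M. (if ?c \<omega> then iexp (\<theta> * (s * Y_bulk \<omega>)) else 0) * iexp (\<theta> * w * X_tail \<omega>)) =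
        (\<lambda>w. ?E ?c (\<lambda>\<omega>. w * X_tail \<omega> + s * Y_bulk \<omega>))"
      by (intro ext Bochner_Integration.integral_cong) (auto simp: exp_add[symmetric] algebra_simps)
    finally show ?thesis .
  qed
  moreover have "((\<lambda>w. ?E ?n (\<lambda>\<omega>. w * X_tail \<omega> + s * (w * Y_tail \<omega>))) \<longlongrightarrow> 0) at_top"
  proof -
    have "((\<lambda>w. CLINT \<omega>|M. (if ?n \<omega> then 1 else 0) * iexp (\<theta> * w * (X_tail \<omega> + s * Y_tail \<omega>))) \<longlongrightarrow> 0) at_top"
      by (rule weighted_tail_tendsto_0) (use assms(7,8) in \<open>auto intro: eventually_mono[OF ac(3)]\<close>)
    also have "(\<lambda>w. CLINT \<omega>|M. (if ?n \<omega> then 1 else 0) * iexp (\<theta> * w * (X_tail \<omega> + s * Y_tail \<omega>))) =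
        (\<lambda>w. ?E ?n (\<lambda>\<omega>. w * X_tail \<omega> + s * (w * Y_tail \<omega>)))"
      by (intro ext Bochner_Integration.integral_cong) (auto simp: algebra_simps)
    finally show ?thesis .
  qed
  ultimately show ?thesis
    using tendsto_add[OF tendsto_add[OF tendsto_add[OF tendsto_const]]] B by fastforce
qed

lemma chf_eventually_pos:
  assumes "((\<lambda>w. chf M \<theta> (X w)) \<longlongrightarrow> of_real r * chf M \<theta> Y) F" "0 < r" "0 < Re (chf M \<theta> Y)"
  shows "\<forall>\<^sub>F w in F. 0 < Re (chf M \<theta> (X w))"
  by (rule order_tendstoD(1)[OF tendsto_Re[OF assms(1)]]) (use assms(2,3) in simp)

text \<open>
  The pairs \<open>(a, b)\<close> for which the characteristic function of \<open>a X + b Y\<close> enters a codifference. The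
  positivity of these is asked for separately because \<open>(X_bulk, Y' v)\<close> is not assumed to be in the
  class; it holds for large \<open>v\<close> by convergence.
\<close>

definition codiff_coeffs :: "(real \<times> real) set" where
  "codiff_coeffs = {(1, 0), (0, 1), (1, 1), (1, - 1)}"

lemma finite_codiff_coeffs [simp]: "finite codiff_coeffs"
  by (simp add: codiff_coeffs_def)

section \<open>Codifferences with one variable decomposed\<close>

lemma (in prob_space) codiff_bulk_tail_tendsto_left:
  assumes c: "c \<in> {sym_codiff M \<theta>, asym_codiff_plus M \<theta>, asym_codiff_minus M \<theta>}"
    and meas: "Measurable.pred M B" "X_bulk \<in> borel_measurable M" "X_tail \<in> borel_measurable M"
      "Y \<in> borel_measurable M"
    and "\<theta> \<noteq> 0" "0 < p"
    and ac: "\<And>N. N \<in> null_sets lborel \<Longrightarrow> AE \<omega> in M. \<not> B \<omega> \<longrightarrow> X_tail \<omega> \<notin> N"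
    and B: "\<And>a b. (CLINT \<omega>|M. if B \<omega> then iexp (\<theta> * (a * X_bulk \<omega> + b * Y \<omega>)) else 0) =
      of_real p * chf M \<theta> (\<lambda>\<omega>. a * X_bulk \<omega> + b * Y \<omega>)"
    and pos: "\<And>a b. (a, b) \<in> codiff_coeffs \<Longrightarrow> 0 < Re (chf M \<theta> (\<lambda>\<omega>. a * X_bulk \<omega> + b * Y \<omega>))"
  shows "((\<lambda>w. c (bulk_tail B X_bulk X_tail w) Y) \<longlongrightarrow> c X_bulk Y) at_top"
proof -
  \<comment> \<open>The choice \<open>b = 0\<close> yields the marginal limit, \<open>b = 1\<close>
    and \<open>b = -1\<close> the two joint ones.\<close>
  have lim: "((\<lambda>w. chf M \<theta> (\<lambda>\<omega>. 1 * bulk_tail B X_bulk X_tail w \<omega> + b * Y \<omega>)) \<longlongrightarrow>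
      of_real p * chf M \<theta> (\<lambda>\<omega>. 1 * X_bulk \<omega> + b * Y \<omega>)) at_top" for b
    using meas \<open>\<theta> \<noteq> 0\<close> ac B by (intro chf_bulk_tail_tendsto) auto
  show ?thesis
  proof (rule codiff_tendsto[OF c \<open>0 < p\<close> zero_less_one])
    show "((\<lambda>w. chf M \<theta> (bulk_tail B X_bulk X_tail w)) \<longlongrightarrow> of_real p * chf M \<theta> X_bulk) at_top"
      using lim[of 0] by simp
    show "0 < Re (chf M \<theta> X_bulk)" "0 < Re (chf M \<theta> Y)"
      using pos[of 1 0] pos[of 0 1] by (simp_all add: codiff_coeffs_def)
    fix s :: real assume s: "s \<in> {1, -1}"
    show "((\<lambda>w. chf M \<theta> (\<lambda>\<omega>. bulk_tail B X_bulk X_tail w \<omega> + s * Y \<omega>)) \<longlongrightarrow>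
        of_real (p * 1) * chf M \<theta> (\<lambda>\<omega>. X_bulk \<omega> + s * Y \<omega>)) at_top"
      using lim[of s] by simp
    show "0 < Re (chf M \<theta> (\<lambda>\<omega>. X_bulk \<omega> + s * Y \<omega>))"
      using pos[of 1 s] s by (auto simp: codiff_coeffs_def)
  qed simp
qed

text \<open>The decomposed variable now stands in the second place and enters the difference with
  coefficient -1, so its coefficient \<open>b\<close> is kept general and nonzero.\<close>

lemma (in prob_space) codiff_bulk_tail_tendsto_right:
  assumes c: "c \<in> {sym_codiff M \<theta>, asym_codiff_plus M \<theta>, asym_codiff_minus M \<theta>}"
    and meas: "Measurable.pred M C" "Y_bulk \<in> borel_measurable M" "Y_tail \<in> borel_measurable M"
      "X \<in> borel_measurable M"
    and "\<theta> \<noteq> 0" "0 < q"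
    and ac: "\<And>N. N \<in> null_sets lborel \<Longrightarrow> AE \<omega> in M. \<not> C \<omega> \<longrightarrow> Y_tail \<omega> \<notin> N"
    and C: "\<And>a b. (CLINT \<omega>|M. if C \<omega> then iexp (\<theta> * (b * Y_bulk \<omega> + a * X \<omega>)) else 0) =
      of_real q * chf M \<theta> (\<lambda>\<omega>. b * Y_bulk \<omega> + a * X \<omega>)"
    and pos: "\<And>a b. (a, b) \<in> codiff_coeffs \<Longrightarrow> 0 < Re (chf M \<theta> (\<lambda>\<omega>. a * X \<omega> + b * Y_bulk \<omega>))"
  shows "((\<lambda>v. c X (bulk_tail C Y_bulk Y_tail v)) \<longlongrightarrow> c X Y_bulk) at_top"
proof -
  have lim: "((\<lambda>v. chf M \<theta> (\<lambda>\<omega>. b * bulk_tail C Y_bulk Y_tail v \<omega> + a * X \<omega>)) \<longlongrightarrow>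
      of_real q * chf M \<theta> (\<lambda>\<omega>. b * Y_bulk \<omega> + a * X \<omega>)) at_top" if "b \<noteq> 0" for a b
    using meas \<open>\<theta> \<noteq> 0\<close> ac C that by (intro chf_bulk_tail_tendsto) auto
  show ?thesis
  proof (rule codiff_tendsto[OF c zero_less_one \<open>0 < q\<close>])
    show "((\<lambda>v. chf M \<theta> (bulk_tail C Y_bulk Y_tail v)) \<longlongrightarrow> of_real q * chf M \<theta> Y_bulk) at_top"
      using lim[of 1 0] by simp
    show "0 < Re (chf M \<theta> X)" "0 < Re (chf M \<theta> Y_bulk)"
      using pos[of 1 0] pos[of 0 1] by (simp_all add: codiff_coeffs_def)
    fix s :: real assume s: "s \<in> {1, -1}"
    then show "((\<lambda>v. chf M \<theta> (\<lambda>\<omega>. X \<omega> + s * bulk_tail C Y_bulk Y_tail v \<omega>)) \<longlongrightarrow>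
        of_real (1 * q) * chf M \<theta> (\<lambda>\<omega>. X \<omega> + s * Y_bulk \<omega>)) at_top"
      using lim[of s 1] by (auto simp: add.commute)
    show "0 < Re (chf M \<theta> (\<lambda>\<omega>. X \<omega> + s * Y_bulk \<omega>))"
      using pos[of 1 s] s by (auto simp: codiff_coeffs_def)
  qed simp
qed

lemma (in prob_space) AE_nonzero:
  assumes [measurable]: "T \<in> borel_measurable M" and "prob {\<omega> \<in> space M. T \<omega> = (0 :: real)} = 0"
  shows "AE \<omega> in M. T \<omega> \<noteq> 0"
proof (rule AE_I[where N = "{\<omega> \<in> space M. T \<omega> = 0}"])
  show "emeasure M {\<omega> \<in> space M. T \<omega> = 0} = 0" using assms by (simp add: emeasure_eq_measure)
qed auto

text \<open>\<open>measure\<close> is 0 on nonmeasurable sets by convention, so positive probability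
  makes the selector measurable.\<close>

lemma pred_of_prob_pos:
  assumes "0 < measure M {\<omega> \<in> space M. B \<omega>}"
  shows "Measurable.pred M B"
  using assms measure_notin_sets[of "{\<omega> \<in> space M. B \<omega>}" M] by (auto simp: pred_def)

lemma eventually_at_top_prod_obtain:
  assumes "\<forall>\<^sub>F (w, v) in at_top \<times>\<^sub>F at_top. P w v"
  obtains w v :: real where "0 < w" "0 < v" "P w v"
proof -
  have "\<forall>\<^sub>F z in at_top \<times>\<^sub>F at_top. 0 < (fst z :: real) \<and> 0 < (snd z :: real)"
    using eventually_prodI[OF eventually_gt_at_top[of "0 :: real"] eventually_gt_at_top[of "0 :: real"]] .
  with assms have "\<forall>\<^sub>F z in at_top \<times>\<^sub>F at_top. P (fst z) (snd z) \<and> 0 < fst z \<and> 0 < snd z"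
    by eventually_elim auto
  then show ?thesis
    using that by (auto dest!: eventually_happens simp: prod_filter_eq_bot)
qed

section \<open>Both variables decomposed\<close>

text \<open>Independence is stated successively: \<open>B\<close> from the four variables, then
  \<open>C\<close> from these together with \<open>B\<close>. This amounts to joint independence of
  \<open>B\<close>, \<open>C\<close> and the tuple of variables.\<close>

locale bulk_tail_pair = prob_space M for M :: "'s measure" +
  fixes \<theta> p q :: real and X_bulk X_tail Y_bulk Y_tail :: "'s \<Rightarrow> real" and B C :: "'s \<Rightarrow> bool"
  assumes theta: "\<theta> \<noteq> 0" and p: "0 < p" "prob {\<omega> \<in> space M. B \<omega>} = p"
    and q: "0 < q" "prob {\<omega> \<in> space M. C \<omega>} = q"
    and meas [measurable]: "X_bulk \<in> borel_measurable M" "X_tail \<in> borel_measurable M"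
      "Y_bulk \<in> borel_measurable M" "Y_tail \<in> borel_measurable M"
    and X_tail: "prob {\<omega> \<in> space M. X_tail \<omega> = 0} = 0"
    and Y_tail: "prob {\<omega> \<in> space M. Y_tail \<omega> = 0} = 0"
    and indepB: "selector_indep M B borel (\<lambda>\<omega>. (X_bulk \<omega>, X_tail \<omega>, Y_bulk \<omega>, Y_tail \<omega>))"
    and indepC: "selector_indep M C (count_space UNIV \<Otimes>\<^sub>M borel)
      (\<lambda>\<omega>. (B \<omega>, X_bulk \<omega>, X_tail \<omega>, Y_bulk \<omega>, Y_tail \<omega>))"
    and D: "pair_in_D M X_bulk Y_bulk"
begin

abbreviation "X \<equiv> bulk_tail B X_bulk X_tail"
abbreviation "Y \<equiv> bulk_tail C Y_bulk Y_tail"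

lemma pred_B [measurable]: "Measurable.pred M B"
  using p by (intro pred_of_prob_pos) simp

lemma pred_C [measurable]: "Measurable.pred M C"
  using q by (intro pred_of_prob_pos) simp

lemma X_measurable [measurable]: "X w \<in> borel_measurable M"
  unfolding bulk_tail_def by measurable

lemma Y_measurable [measurable]: "Y w \<in> borel_measurable M"
  unfolding bulk_tail_def by measurable

abbreviation lin :: "real \<Rightarrow> real \<Rightarrow> real \<Rightarrow> real \<Rightarrow> 's \<Rightarrow> real" where
  "lin a b c d \<omega> \<equiv> a * X_bulk \<omega> + b * X_tail \<omega> + c * Y_bulk \<omega> + d * Y_tail \<omega>"

lemma tuple_measurable:
  "(\<lambda>\<omega>. (X_bulk \<omega>, X_tail \<omega>, Y_bulk \<omega>, Y_tail \<omega>)) \<in> borel_measurable M"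
  by (intro borel_measurable_Pair meas)

lemma iexp_tuple_measurable:
  "(\<lambda>v :: real \<times> real \<times> real \<times> real. iexp (\<theta> * (a * fst v + b * fst (snd v) +
    c * fst (snd (snd v)) + d * snd (snd (snd v))))) \<in> borel_measurable borel"
  by (intro borel_measurable_continuous_onI continuous_intros)

lemma integral_B:
  "(CLINT \<omega>|M. if B \<omega> then iexp (\<theta> * lin a b c d \<omega>) else 0) = of_real p * chf M \<theta> (lin a b c d)"
  using selector_indep_integral[OF indepB tuple_measurable iexp_tuple_measurable[of a b c d]]
  unfolding fst_conv snd_conv chf_def p(2) .

text \<open>An integrand that switches with \<open>B\<close> is a measurable function of the pair
  \<open>(B, V)\<close>, which is what \<open>indepC\<close> covers.\<close>

lemma integral_C_gen:
  fixes g h :: "real \<times> real \<times> real \<times> real \<Rightarrow> complex"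
  assumes [measurable]: "g \<in> borel_measurable borel" "h \<in> borel_measurable borel"
  defines "V \<equiv> \<lambda>\<omega>. (X_bulk \<omega>, X_tail \<omega>, Y_bulk \<omega>, Y_tail \<omega>)"
  shows "(CLINT \<omega>|M. if C \<omega> then (if B \<omega> then g (V \<omega>) else h (V \<omega>)) else 0) =
    of_real q * (CLINT \<omega>|M. if B \<omega> then g (V \<omega>) else h (V \<omega>))"
proof -
  have [measurable]: "V \<in> borel_measurable M" unfolding V_def by (rule tuple_measurable)
  have "(\<lambda>x. if fst x then g (snd x) else h (snd x)) \<in> borel_measurable (count_space UNIV \<Otimes>\<^sub>M borel)"
    by measurable
  moreover have "(\<lambda>\<omega>. (B \<omega>, V \<omega>)) \<in> measurable M (count_space UNIV \<Otimes>\<^sub>M borel)"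
    by measurable
  ultimately show ?thesis
    using selector_indep_integral[OF indepC, of "\<lambda>x. if fst x then g (snd x) else h (snd x)"]
    unfolding V_def q(2) fst_conv snd_conv by simp
qed

lemma integral_C:
  "(CLINT \<omega>|M. if C \<omega> then (if B \<omega> then iexp (\<theta> * lin a b c d \<omega>) else iexp (\<theta> * lin a' b' c' d' \<omega>)) else 0) =
    of_real q * (CLINT \<omega>|M. if B \<omega> then iexp (\<theta> * lin a b c d \<omega>) else iexp (\<theta> * lin a' b' c' d' \<omega>))"
  using integral_C_gen[OF iexp_tuple_measurable iexp_tuple_measurable, of a b c d a' b' c' d']
  unfolding fst_conv snd_conv .

lemma integral_C_B:
  "(CLINT \<omega>|M. if C \<omega> then (if B \<omega> then iexp (\<theta> * lin a b c d \<omega>) else 0) else 0) =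
    of_real q * (CLINT \<omega>|M. if B \<omega> then iexp (\<theta> * lin a b c d \<omega>) else 0)"
  using integral_C_gen[where h = "\<lambda>_. 0", OF iexp_tuple_measurable borel_measurable_const, of a b c d]
  unfolding fst_conv snd_conv .

lemma integral_C_only:
  "(CLINT \<omega>|M. if C \<omega> then iexp (\<theta> * lin a b c d \<omega>) else 0) = of_real q * chf M \<theta> (lin a b c d)"
  using integral_C[of a b c d a b c d] unfolding if_cancel chf_def .

text \<open>
  Only independence of \<open>B\<close> from the four variables is assumed; independence from \<open>(C, \<dots>)\<close> comes
  from the independence of \<open>C\<close>.
\<close>

lemma integral_B_Y:
  "(CLINT \<omega>|M. if B \<omega> then iexp (\<theta> * (a * X_bulk \<omega> + b * Y v \<omega>)) else 0) =
    of_real p * chf M \<theta> (\<lambda>\<omega>. a * X_bulk \<omega> + b * Y v \<omega>)"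
proof -
  let ?G = "\<lambda>\<omega>. iexp (\<theta> * lin a 0 b 0 \<omega>)" and ?H = "\<lambda>\<omega>. iexp (\<theta> * lin a 0 0 (b * v) \<omega>)"
  have eq: "iexp (\<theta> * (a * X_bulk \<omega> + b * Y v \<omega>)) = (if C \<omega> then ?G \<omega> else ?H \<omega>)" for \<omega>
    by (simp add: bulk_tail_def mult.assoc)
  show ?thesis
    unfolding chf_def eq
  proof (rule selector_swap_integral[OF pred_B pred_C])
    show "integrable M ?G" "integrable M ?H"
      by (auto intro!: integrable_const_bound[of _ 1])
    show "(CLINT \<omega>|M. if B \<omega> then ?G \<omega> else 0) = of_real p * (CLINT \<omega>|M. ?G \<omega>)"
      using integral_B unfolding chf_def .
    show "(CLINT \<omega>|M. if B \<omega> then ?H \<omega> else 0) = of_real p * (CLINT \<omega>|M. ?H \<omega>)"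
      using integral_B unfolding chf_def .
    show "(CLINT \<omega>|M. if C \<omega> then F \<omega> else 0) = of_real q * (CLINT \<omega>|M. F \<omega>)"
      if "F \<in> {?G, ?H, \<lambda>\<omega>. if B \<omega> then ?G \<omega> else 0, \<lambda>\<omega>. if B \<omega> then ?H \<omega> else 0}" for F
      using that integral_C_only[unfolded chf_def] integral_C_B by (elim insertE emptyE) (simp_all only:)
  qed
qed

lemma integral_C_X:
  "(CLINT \<omega>|M. if C \<omega> then iexp (\<theta> * (b * Y_bulk \<omega> + a * X w \<omega>)) else 0) =
    of_real q * chf M \<theta> (\<lambda>\<omega>. b * Y_bulk \<omega> + a * X w \<omega>)"
proof -
  have eq: "iexp (\<theta> * (b * Y_bulk \<omega> + a * X w \<omega>)) =
      (if B \<omega> then iexp (\<theta> * lin a 0 b 0 \<omega>) else iexp (\<theta> * lin 0 (a * w) b 0 \<omega>))" for \<omega>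
    by (simp add: bulk_tail_def add.commute mult.assoc)
  show ?thesis
    unfolding chf_def eq by (rule integral_C)
qed

lemma integral_B_C:
  "(CLINT \<omega>|M. if B \<omega> \<and> C \<omega> then iexp (\<theta> * (X_bulk \<omega> + s * Y_bulk \<omega>)) else 0) =
    of_real (p * q) * chf M \<theta> (\<lambda>\<omega>. X_bulk \<omega> + s * Y_bulk \<omega>)"
proof -
  have "(CLINT \<omega>|M. if B \<omega> \<and> C \<omega> then iexp (\<theta> * (X_bulk \<omega> + s * Y_bulk \<omega>)) else 0) =
      (CLINT \<omega>|M. if C \<omega> then (if B \<omega> then iexp (\<theta> * lin 1 0 s 0 \<omega>) else 0) else 0)"
    by (rule Bochner_Integration.integral_cong) auto
  then show ?thesis
    unfolding integral_C_B integral_B by simp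
qed

lemma integral_B_Y_bulk:
  "(CLINT \<omega>|M. if B \<omega> then iexp (\<theta> * (a * X_bulk \<omega> + b * Y_bulk \<omega>)) else 0) =
    of_real p * chf M \<theta> (\<lambda>\<omega>. a * X_bulk \<omega> + b * Y_bulk \<omega>)"
  using integral_B[of a 0 b 0] by (simp cong: if_cong)

lemma integral_C_X_bulk:
  "(CLINT \<omega>|M. if C \<omega> then iexp (\<theta> * (b * Y_bulk \<omega> + a * X_bulk \<omega>)) else 0) =
    of_real q * chf M \<theta> (\<lambda>\<omega>. b * Y_bulk \<omega> + a * X_bulk \<omega>)"
  using integral_C_only[of a 0 b 0] by (simp add: add.commute cong: if_cong)

lemma bulk_pos: "0 < Re (chf M \<theta> (\<lambda>\<omega>. a * X_bulk \<omega> + b * Y_bulk \<omega>))"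
  by (rule chf_pos_of_pair_in_D[OF D meas(1,3)])

lemma X_tail_ac:
  assumes "pair_in_D M (X w) (Y v)" "0 < w" "N \<in> null_sets lborel"
  shows "AE \<omega> in M. \<not> B \<omega> \<longrightarrow> X_tail \<omega> \<notin> N"
  by (rule tail_ac[OF assms(1) X_measurable Y_measurable AE_nonzero[OF meas(2) X_tail], where a = 1 and b = 0 and w = w])
    (use assms in \<open>auto simp: bulk_tail_def\<close>)

lemma Y_tail_ac:
  assumes "pair_in_D M (X w) (Y v)" "0 < v" "N \<in> null_sets lborel"
  shows "AE \<omega> in M. \<not> C \<omega> \<longrightarrow> Y_tail \<omega> \<notin> N"
  by (rule tail_ac[OF assms(1) X_measurable Y_measurable AE_nonzero[OF meas(4) Y_tail], where a = 0 and b = 1 and w = v])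
    (use assms in \<open>auto simp: bulk_tail_def\<close>)

text \<open>On the double tail event \<open>X w + s * Y w\<close> equals
  \<open>w * (X_tail + s * Y_tail)\<close>; the common scale is essential for factoring out
  \<open>w\<close>.\<close>

lemma tails_ac:
  assumes "pair_in_D M (X w) (Y w)" "0 < w" "N \<in> null_sets lborel"
    and "prob {\<omega> \<in> space M. X_tail \<omega> + s * Y_tail \<omega> = 0} = 0"
  shows "AE \<omega> in M. \<not> B \<omega> \<and> \<not> C \<omega> \<longrightarrow> X_tail \<omega> + s * Y_tail \<omega> \<notin> N"
proof (rule tail_ac[OF assms(1) X_measurable Y_measurable, where a = 1 and b = s and w = w])
  show "AE \<omega> in M. X_tail \<omega> + s * Y_tail \<omega> \<noteq> 0"
    by (rule AE_nonzero[OF _ assms(4)]) measurable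
qed (use assms in \<open>auto simp: bulk_tail_def algebra_simps\<close>)

lemma iterated_limits:
  assumes ev: "\<forall>\<^sub>F (w, v) in at_top \<times>\<^sub>F at_top. pair_in_D M (X w) (Y v)"
    and c: "c \<in> {sym_codiff M \<theta>, asym_codiff_plus M \<theta>, asym_codiff_minus M \<theta>}"
  shows "\<forall>\<^sub>F v in at_top. ((\<lambda>w. c (X w) (Y v)) \<longlongrightarrow> c X_bulk (Y v)) at_top" (is ?XY)
    and "((\<lambda>v. c X_bulk (Y v)) \<longlongrightarrow> c X_bulk Y_bulk) at_top" (is ?Y)
    and "\<forall>\<^sub>F w in at_top. ((\<lambda>v. c (X w) (Y v)) \<longlongrightarrow> c (X w) Y_bulk) at_top" (is ?YX)
    and "((\<lambda>w. c (X w) Y_bulk) \<longlongrightarrow> c X_bulk Y_bulk) at_top" (is ?X)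
proof -
  \<comment> \<open>One pair of positive scales is enough: the absolute continuity drawn from it
    concerns the unscaled tails.\<close>
  obtain w v where wv: "0 < w" "0 < v" "pair_in_D M (X w) (Y v)"
    by (rule eventually_at_top_prod_obtain[OF ev])
  have X_ac: "AE \<omega> in M. \<not> B \<omega> \<longrightarrow> X_tail \<omega> \<notin> N" if "N \<in> null_sets lborel" for N
    using wv that by (intro X_tail_ac)
  have Y_ac: "AE \<omega> in M. \<not> C \<omega> \<longrightarrow> Y_tail \<omega> \<notin> N" if "N \<in> null_sets lborel" for N
    using wv that by (intro Y_tail_ac)
  have "\<forall>\<^sub>F v in at_top. 0 < Re (chf M \<theta> (\<lambda>\<omega>. a * X_bulk \<omega> + b * Y v \<omega>))" for a b
  proof (cases "b = 0")
    case True
    then show ?thesis using bulk_pos[of a 0] by simp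
  next
    case False
    have "((\<lambda>v. chf M \<theta> (\<lambda>\<omega>. b * Y v \<omega> + a * X_bulk \<omega>)) \<longlongrightarrow>
        of_real q * chf M \<theta> (\<lambda>\<omega>. b * Y_bulk \<omega> + a * X_bulk \<omega>)) at_top"
      by (rule chf_bulk_tail_tendsto[OF pred_C _ _ _ theta False Y_ac integral_C_X_bulk]) measurable
    from chf_eventually_pos[OF this q(1)] show ?thesis
      using bulk_pos[of a b] by (simp add: add.commute)
  qed
  \<comment> \<open>Finiteness of \<open>codiff_coeffs\<close> gives one threshold for
    \<open>v\<close> that serves all coefficients.\<close>
  then have "\<forall>\<^sub>F v in at_top. \<forall>(a, b)\<in>codiff_coeffs. 0 < Re (chf M \<theta> (\<lambda>\<omega>. a * X_bulk \<omega> + b * Y v \<omega>))"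
    by (auto intro!: eventually_ball_finite)
  then show ?XY
  proof eventually_elim
    case (elim v)
    show ?case
      by (rule codiff_bulk_tail_tendsto_left[OF c pred_B meas(1,2) Y_measurable theta p(1) X_ac integral_B_Y])
        (use elim in auto)
  qed
  have "\<forall>\<^sub>F w in at_top. 0 < Re (chf M \<theta> (\<lambda>\<omega>. a * X w \<omega> + b * Y_bulk \<omega>))" for a b
  proof (cases "a = 0")
    case True
    then show ?thesis using bulk_pos[of 0 b] by simp
  next
    case False
    have "((\<lambda>w. chf M \<theta> (\<lambda>\<omega>. a * X w \<omega> + b * Y_bulk \<omega>)) \<longlongrightarrow>
        of_real p * chf M \<theta> (\<lambda>\<omega>. a * X_bulk \<omega> + b * Y_bulk \<omega>)) at_top"
      by (rule chf_bulk_tail_tendsto[OF pred_B _ _ _ theta False X_ac integral_B_Y_bulk]) measurable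
    from chf_eventually_pos[OF this p(1) bulk_pos] show ?thesis .
  qed
  then have "\<forall>\<^sub>F w in at_top. \<forall>(a, b)\<in>codiff_coeffs. 0 < Re (chf M \<theta> (\<lambda>\<omega>. a * X w \<omega> + b * Y_bulk \<omega>))"
    by (auto intro!: eventually_ball_finite)
  then show ?YX
  proof eventually_elim
    case (elim w)
    show ?case
      by (rule codiff_bulk_tail_tendsto_right[OF c pred_C meas(3,4) X_measurable theta q(1) Y_ac integral_C_X])
        (use elim in auto)
  qed
  show ?Y
    by (rule codiff_bulk_tail_tendsto_right[OF c pred_C meas(3,4,1) theta q(1) Y_ac integral_C_X_bulk bulk_pos])
  show ?X
    by (rule codiff_bulk_tail_tendsto_left[OF c pred_B meas(1,2,3) theta p(1) X_ac integral_B_Y_bulk bulk_pos])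
qed

lemma joint_limit:
  assumes ev: "\<forall>\<^sub>F w in at_top. pair_in_D M (X w) (Y w)"
    and tails: "prob {\<omega> \<in> space M. X_tail \<omega> + Y_tail \<omega> = 0} = 0"
      "prob {\<omega> \<in> space M. X_tail \<omega> - Y_tail \<omega> = 0} = 0"
    and c: "c \<in> {sym_codiff M \<theta>, asym_codiff_plus M \<theta>, asym_codiff_minus M \<theta>}"
  shows "((\<lambda>w. c (X w) (Y w)) \<longlongrightarrow> c X_bulk Y_bulk) at_top"
proof -
  obtain w where w: "0 < w" "pair_in_D M (X w) (Y w)"
    using eventually_happens[OF eventually_conj[OF ev eventually_gt_at_top[of 0]]] by auto
  show ?thesis
  proof (rule codiff_tendsto[OF c p(1) q(1)])
    \<comment> \<open>The marginal limits are the case where the other summand \<open>U\<close> is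
      the constant 0.\<close>
    show "((\<lambda>w. chf M \<theta> (X w)) \<longlongrightarrow> of_real p * chf M \<theta> X_bulk) at_top"
      using chf_bulk_tail_tendsto[OF pred_B meas(1,2) borel_measurable_const theta one_neq_zero
          X_tail_ac[OF w(2,1)], of 0 "of_real p"] integral_B[of 1 0 0 0]
      by (simp cong: if_cong)
    show "((\<lambda>w. chf M \<theta> (Y w)) \<longlongrightarrow> of_real q * chf M \<theta> Y_bulk) at_top"
      using chf_bulk_tail_tendsto[OF pred_C meas(3,4) borel_measurable_const theta one_neq_zero
          Y_tail_ac[OF w(2,1)], of 0 "of_real q"] integral_C_only[of 0 0 1 0]
      by (simp cong: if_cong)
    show "0 < Re (chf M \<theta> X_bulk)" "0 < Re (chf M \<theta> Y_bulk)"
      using bulk_pos[of 1 0] bulk_pos[of 0 1] by simp_all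
    fix s :: real assume s: "s \<in> {1, -1}"
    have "prob {\<omega> \<in> space M. X_tail \<omega> + s * Y_tail \<omega> = 0} = 0" using s tails by auto
    then show "((\<lambda>w. chf M \<theta> (\<lambda>\<omega>. X w \<omega> + s * Y w \<omega>)) \<longlongrightarrow>
        of_real (p * q) * chf M \<theta> (\<lambda>\<omega>. X_bulk \<omega> + s * Y_bulk \<omega>)) at_top"
      using s by (intro chf_bulk_tail_joint_tendsto pred_B pred_C meas theta integral_B_C
          X_tail_ac[OF w(2,1)] Y_tail_ac[OF w(2,1)] tails_ac[OF w(2,1)]) auto
    show "0 < Re (chf M \<theta> (\<lambda>\<omega>. X_bulk \<omega> + s * Y_bulk \<omega>))"
      using bulk_pos[of 1 s] by simp
  qed
qed

end

theorem proposition6: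
  fixes M :: "'s measure" and \<theta> p q :: real
    and X_bulk X_tail Y Y_bulk Y_tail :: "'s \<Rightarrow> real" and B C :: "'s \<Rightarrow> bool"
  defines "X \<equiv> bulk_tail B X_bulk X_tail"
  defines "Y' \<equiv> bulk_tail C Y_bulk Y_tail"
  defines "codiffs \<equiv> {sym_codiff M \<theta>, asym_codiff_plus M \<theta>, asym_codiff_minus M \<theta>}"
  assumes "prob_space M" and "\<theta> \<noteq> 0"
    and "X_bulk \<in> borel_measurable M" and "X_tail \<in> borel_measurable M"
    and "0 < p" and "measure M {\<omega> \<in> space M. B \<omega>} = p"
    and "measure M {\<omega> \<in> space M. X_tail \<omega> = 0} = 0"
  shows
    "(Y \<in> borel_measurable M
        \<and> selector_indep M B borel (\<lambda>\<omega>. (X_bulk \<omega>, X_tail \<omega>, Y \<omega>))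
        \<and> pair_in_D M X_bulk Y
        \<and> (\<forall>\<^sub>F w in at_top. pair_in_D M (X w) Y)
      \<longrightarrow> (\<forall>c\<in>codiffs. ((\<lambda>w. c (X w) Y) \<longlongrightarrow> c X_bulk Y) at_top))
   \<and> (Y_bulk \<in> borel_measurable M \<and> Y_tail \<in> borel_measurable M
        \<and> 0 < q \<and> measure M {\<omega> \<in> space M. C \<omega>} = q
        \<and> measure M {\<omega> \<in> space M. Y_tail \<omega> = 0} = 0
        \<and> selector_indep M B borel
            (\<lambda>\<omega>. (X_bulk \<omega>, X_tail \<omega>, Y_bulk \<omega>, Y_tail \<omega>))
        \<and> selector_indep M C (count_space UNIV \<Otimes>\<^sub>M borel)
            (\<lambda>\<omega>. (B \<omega>, X_bulk \<omega>, X_tail \<omega>, Y_bulk \<omega>, Y_tail \<omega>))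
        \<and> pair_in_D M X_bulk Y_bulk
      \<longrightarrow>
        ((\<forall>\<^sub>F (w, v) in at_top \<times>\<^sub>F at_top. pair_in_D M (X w) (Y' v))
         \<longrightarrow> (\<forall>c\<in>codiffs.
               (\<forall>\<^sub>F v in at_top. ((\<lambda>w. c (X w) (Y' v)) \<longlongrightarrow> c X_bulk (Y' v)) at_top)
             \<and> ((\<lambda>v. c X_bulk (Y' v)) \<longlongrightarrow> c X_bulk Y_bulk) at_top
             \<and> (\<forall>\<^sub>F w in at_top. ((\<lambda>v. c (X w) (Y' v)) \<longlongrightarrow> c (X w) Y_bulk) at_top)
             \<and> ((\<lambda>w. c (X w) Y_bulk) \<longlongrightarrow> c X_bulk Y_bulk) at_top))
      \<and> ((\<forall>\<^sub>F w in at_top. pair_in_D M (X w) (Y' w))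
           \<and> measure M {\<omega> \<in> space M. X_tail \<omega> + Y_tail \<omega> = 0} = 0
           \<and> measure M {\<omega> \<in> space M. X_tail \<omega> - Y_tail \<omega> = 0} = 0
         \<longrightarrow> (\<forall>c\<in>codiffs. ((\<lambda>w. c (X w) (Y' w)) \<longlongrightarrow> c X_bulk Y_bulk) at_top)))"
proof -
  interpret prob_space M by fact
  note [measurable] = \<open>X_bulk \<in> borel_measurable M\<close> \<open>X_tail \<in> borel_measurable M\<close>
  have predB [measurable]: "Measurable.pred M B" using assms by (intro pred_of_prob_pos) simp
  have X_meas [measurable]: "X w \<in> borel_measurable M" for w
    unfolding X_def bulk_tail_def by measurable
  have X_ac: "AE \<omega> in M. \<not> B \<omega> \<longrightarrow> X_tail \<omega> \<notin> N"
    if "pair_in_D M (X w) Y" "Y \<in> borel_measurable M" "0 < w" "N \<in> null_sets lborel" for w N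
    by (rule tail_ac[OF that(1) X_meas that(2) AE_nonzero, where a = 1 and b = 0 and w = w])
      (use that assms in \<open>auto simp: bulk_tail_def\<close>)
  show ?thesis
  proof (rule conjI, goal_cases)
    case 1
    show ?case
    proof (rule impI, elim conjE)
      assume [measurable]: "Y \<in> borel_measurable M"
        and indep: "selector_indep M B borel (\<lambda>\<omega>. (X_bulk \<omega>, X_tail \<omega>, Y \<omega>))"
        and D: "pair_in_D M X_bulk Y" and ev: "\<forall>\<^sub>F w in at_top. pair_in_D M (X w) Y"
      obtain w where w: "0 < w" "pair_in_D M (X w) Y"
        using eventually_happens[OF eventually_conj[OF ev eventually_gt_at_top[of 0]]] by auto
      show "\<forall>c\<in>codiffs. ((\<lambda>w. c (X w) Y) \<longlongrightarrow> c X_bulk Y) at_top"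
        unfolding X_def
      proof (intro ballI, rule codiff_bulk_tail_tendsto_left[where p = p])
        show "AE \<omega> in M. \<not> B \<omega> \<longrightarrow> X_tail \<omega> \<notin> N" if "N \<in> null_sets lborel" for N
          using X_ac w that by auto
        show "0 < Re (chf M \<theta> (\<lambda>\<omega>. a * X_bulk \<omega> + b * Y \<omega>))" for a b
          by (rule chf_pos_of_pair_in_D[OF D]) measurable
        show "(CLINT \<omega>|M. if B \<omega> then iexp (\<theta> * (a * X_bulk \<omega> + b * Y \<omega>)) else 0) =
            of_real p * chf M \<theta> (\<lambda>\<omega>. a * X_bulk \<omega> + b * Y \<omega>)" for a b
        proof -
          \<comment> \<open>The exponential as a function of the triple
            \<open>(X_bulk, X_tail, Y)\<close>, constant in the middle component.\<close>
          have "(\<lambda>v :: real \<times> real \<times> real. iexp (\<theta> * (a * fst v + b * snd (snd v)))) \<in> borel_measurable borel"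
            by (intro borel_measurable_continuous_onI continuous_intros)
          from selector_indep_integral[OF indep _ this] show ?thesis
            using assms by (simp add: chf_def borel_measurable_Pair cong: if_cong)
        qed
      qed (use assms in \<open>auto simp: codiffs_def\<close>)
    qed
  next
    case 2
    show ?case
    proof (rule impI, goal_cases)
      case 1
      interpret bulk_tail_pair M \<theta> p q X_bulk X_tail Y_bulk Y_tail B C
        by unfold_locales (use 1 assms in auto)
      show ?case
        unfolding X_def Y'_def codiffs_def
        by (intro conjI impI ballI;
            ((rule iterated_limits; assumption) | (elim conjE, rule joint_limit; assumption)))
    qed
  qed
qed

end
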